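(* There exists a constant $C$ depending only on $d,n$ such that the following holds. For every $f_1,f_2\in L^1(\mathbb{R}^d;\mathbb{R}^n)$ with compact support and every dyadic lattice $\mathcal D$ of $\mathbb{R}^d$ there exists a sparse collection $\mathcal S_{\mathcal D}\subset\mathcal D$ such that for all integers $\varrho\ge1$ \[ \sup_{\mathbb S^\varrho}|\mathbb S^\varrho\otimes\mathrm{Id}_{\mathbb{R}^n}(f_1,f_2)|\leq C\varrho\sum_{Q\in\mathcal S_{\mathcal D}}|Q|\langle f_1\rangle_Q\langle f_2\rangle_Q, \] the supremum being taken over all dyadic shifts $\mathbb S^\varrho$ of complexity $\varrho$ constructed on $\mathcal D$.
   Context: Dyadic shift: for a dyadic lattice $\mathcal D$ and nonnegative integers $m_1,m_2$, a bilinear form $\mathbb S^\varrho(f_1,f_2)=\sum_{Q\in\mathcal D}\int_{Q\times Q}s_Q(x_1,x_2)f_1(x_1)f_2(x_2)\,dx_1dx_2$ on scalar functions with $\varrho=\max\{1,m_1,m_2\}$, such that (A1) $s_Q$ vanishes for all but finitely many $Q$ and $\|s_Q\|_\infty\le|Q|^{-1}$; (A2) for every subcollection $\mathcal Q\subset\mathcal D$ the partial sum over $Q\in\mathcal Q$ is bounded in absolute value by $\|f_1\|_2\|f_2\|_2$; (A3) if $R\in\mathcal D$, $R\subset Q$, $\ell(R)<2^{-m_1}\ell(Q)$ then $s_Q(\cdot,x_2)$ is constant on $R$ for all $x_2\in Q$, and symmetrically (with $m_2$) in the other variable. For $\mathbb{R}^n$-valued $f_1,f_2$ with coordinates $f_{i,j}$,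 $\mathbb S^\varrho\otimes\mathrm{Id}_{\mathbb{R}^n}(f_1,f_2):=\sum_{j=1}^n\mathbb S^\varrho(f_{1,j},f_{2,j})$. For a cube $Q$ let $\Phi(Q)$ be the set of real functions $\varphi$ on $\mathbb{R}^d$ with $\|\varphi\|_\infty\le1$ and support in $Q$; for $f\in L^1_{\mathrm{loc}}(\mathbb{R}^d;\mathbb{R}^n)$, $\langle f\rangle_Q:=\{\frac1{|Q|}\int f\varphi\,dx:\varphi\in\Phi(Q)\}\subset\mathbb{R}^n$, a closed convex symmetric set. For closed convex symmetric sets $K,H\subset\mathbb{R}^n$, $KH$ denotes the right endpoint of the interval $\{k\cdot h:k\in K,h\in H\}$ (i.e. $\sup_{k\in K,h\in H}k\cdot h$). A collection $\mathcal S$ of cubes is sparse if for a fixed $\eta\in(0,1)$ each $Q\in\mathcal S$ contains $E_Q$ with $|E_Q|\ge\eta|Q|$ and the $E_Q$ are pairwise disjoint. *)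

theory Defs
  imports "HOL-Analysis.Analysis"
begin

definition cube :: "real^'d \<Rightarrow> real \<Rightarrow> (real^'d) set" where
  "cube a l = {x. \<forall>i. a$i \<le> x$i \<and> x$i < a$i + l}"

definition is_cube :: "(real^'d) set \<Rightarrow> bool" where
  "is_cube Q \<longleftrightarrow> (\<exists>a l. l > 0 \<and> Q = cube a l)"

definition sidelen :: "(real^'d) set \<Rightarrow> real" where
  "sidelen Q = (THE l. \<exists>a. l > 0 \<and> Q = cube a l)"

definition dyadic_child :: "(real^'d) set \<Rightarrow> (real^'d) set \<Rightarrow> bool" where
  "dyadic_child Q' Q \<longleftrightarrow> (\<exists>a l e. l > 0 \<and> Q = cube a l \<and> (\<forall>i. e$i \<in> {0,1})
       \<and> Q' = cube (a + (l/2) *\<^sub>R e) (l/2))"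

definition dyadic_desc :: "(real^'d) set \<Rightarrow> (real^'d) set \<Rightarrow> bool" where
  "dyadic_desc = dyadic_child\<^sup>*\<^sup>*"

text \<open>Dyadic lattice in the sense of Lerner--Nazarov.\<close>
definition dyadic_lattice :: "(real^'d) set set \<Rightarrow> bool" where
  "dyadic_lattice D \<longleftrightarrow>
     (\<forall>Q\<in>D. is_cube Q)
   \<and> (\<forall>Q\<in>D. \<forall>Q'. dyadic_child Q' Q \<longrightarrow> Q' \<in> D)
   \<and> (\<forall>Q1\<in>D. \<forall>Q2\<in>D. \<exists>Q\<in>D. dyadic_desc Q1 Q \<and> dyadic_desc Q2 Q)
   \<and> (\<forall>K. compact K \<longrightarrow> (\<exists>Q\<in>D. K \<subseteq> Q))"

definition sparse :: "real \<Rightarrow> (real^'d) set set \<Rightarrow> bool" where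
  "sparse \<eta> S \<longleftrightarrow> (\<exists>E. (\<forall>Q\<in>S. E Q \<subseteq> Q \<and> E Q \<in> sets lebesgue
          \<and> measure lebesgue (E Q) \<ge> \<eta> * measure lebesgue Q)
      \<and> (\<forall>Q\<in>S. \<forall>Q'\<in>S. Q \<noteq> Q' \<longrightarrow> E Q \<inter> E Q' = {}))"

definition shift_form ::
  "(real^'d) set set \<Rightarrow> ((real^'d) set \<Rightarrow> real^'d \<Rightarrow> real^'d \<Rightarrow> real)
     \<Rightarrow> (real^'d \<Rightarrow> real) \<Rightarrow> (real^'d \<Rightarrow> real) \<Rightarrow> real" where
  "shift_form QQ s g1 g2 =
     (\<Sum>Q\<in>{Q\<in>QQ. \<exists>x1\<in>Q. \<exists>x2\<in>Q. s Q x1 x2 \<noteq> 0}.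
        integral\<^sup>L (lebesgue \<Otimes>\<^sub>M lebesgue)
          (\<lambda>(x1,x2). indicator (Q \<times> Q) (x1,x2) * s Q x1 x2 * g1 x1 * g2 x2))"

definition L2_fun :: "(real^'d \<Rightarrow> real) \<Rightarrow> bool" where
  "L2_fun g \<longleftrightarrow> g \<in> borel_measurable lebesgue \<and> integrable lebesgue (\<lambda>x. (g x)^2)"

definition L2_norm :: "(real^'d \<Rightarrow> real) \<Rightarrow> real" where
  "L2_norm g = sqrt (integral\<^sup>L lebesgue (\<lambda>x. (g x)^2))"

text \<open>s is a dyadic shift on D with parameters m1, m2 (complexity max 1 m1 m2).\<close>
definition dyadic_shift ::
  "(real^'d) set set \<Rightarrow> nat \<Rightarrow> nat \<Rightarrow> ((real^'d) set \<Rightarrow> real^'d \<Rightarrow> real^'d \<Rightarrow> real) \<Rightarrow> bool" where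
  "dyadic_shift D m1 m2 s \<longleftrightarrow>
     finite {Q\<in>D. \<exists>x1\<in>Q. \<exists>x2\<in>Q. s Q x1 x2 \<noteq> 0}
   \<and> (\<forall>Q\<in>D. \<forall>x1\<in>Q. \<forall>x2\<in>Q. \<bar>s Q x1 x2\<bar> \<le> 1 / measure lebesgue Q)
   \<and> (\<forall>QQ. QQ \<subseteq> D \<longrightarrow> (\<forall>g1 g2. L2_fun g1 \<and> L2_fun g2 \<longrightarrow>
        \<bar>shift_form QQ s g1 g2\<bar> \<le> L2_norm g1 * L2_norm g2))
   \<and> (\<forall>Q\<in>D. \<forall>R\<in>D. R \<subseteq> Q \<and> sidelen R < sidelen Q / 2^m1 \<longrightarrow>
        (\<forall>x2\<in>Q. \<forall>x1\<in>R. \<forall>y1\<in>R. s Q x1 x2 = s Q y1 x2))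
   \<and> (\<forall>Q\<in>D. \<forall>R\<in>D. R \<subseteq> Q \<and> sidelen R < sidelen Q / 2^m2 \<longrightarrow>
        (\<forall>x1\<in>Q. \<forall>x2\<in>R. \<forall>y2\<in>R. s Q x1 x2 = s Q x1 y2))"

definition shift_form_vec ::
  "(real^'d) set set \<Rightarrow> ((real^'d) set \<Rightarrow> real^'d \<Rightarrow> real^'d \<Rightarrow> real)
     \<Rightarrow> (real^'d \<Rightarrow> real^'n) \<Rightarrow> (real^'d \<Rightarrow> real^'n) \<Rightarrow> real" where
  "shift_form_vec D s f1 f2 = (\<Sum>j\<in>UNIV. shift_form D s (\<lambda>x. f1 x $ j) (\<lambda>x. f2 x $ j))"

definition avg_set :: "(real^'d \<Rightarrow> real^'n) \<Rightarrow> (real^'d) set \<Rightarrow> (real^'n) set" where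
  "avg_set f Q = {(1 / measure lebesgue Q) *\<^sub>R integral\<^sup>L lebesgue (\<lambda>x. \<phi> x *\<^sub>R f x) | \<phi>.
      \<phi> \<in> borel_measurable lebesgue \<and> (\<forall>x. \<bar>\<phi> x\<bar> \<le> 1) \<and> (\<forall>x. x \<notin> Q \<longrightarrow> \<phi> x = 0)}"

definition set_pair :: "(real^'n) set \<Rightarrow> (real^'n) set \<Rightarrow> real" where
  "set_pair K H = Sup {k \<bullet> h | k h. k \<in> K \<and> h \<in> H}"

definition compact_support :: "(real^'d \<Rightarrow> real^'n) \<Rightarrow> bool" where
  "compact_support f \<longleftrightarrow> (\<exists>K. compact K \<and> (\<forall>x. x \<notin> K \<longrightarrow> f x = 0))"

end

theory Submission
  imports Defs
begin

text \<open>
  On a cube Q0, a basis b_i almost adapted to the convex body of averages of f1 (with dual vectors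
  w_i) turns the vector form into a sum of scalar forms in g_i = w_i . f1 and h_i = b_i . f2, where
  g_i has mean size O(1) on Q0 and h_i has mean size at most the product of the two convex bodies.
  Stop at the maximal dyadic cubes where some mean of a g_i or h_i exceeds a large multiple of its
  mean over Q0; these cubes do not depend on the shift and fill at most half of Q0. For the cubes
  of the shift not contained in a stopping cube, use a Calderon-Zygmund decomposition: the good
  parts are handled by the L2 bound of the shift, and a mean zero bad part on a cube P is killed by
  every cube of the shift more than m generations above P, so at most m + 1 cubes contribute.
  Iterating the selection from a top cube containing both supports gives the sparse family.
\<close>

section \<open>Dyadic cubes\<close>

text \<open>The family has to be fixed before the complexity and the shift, so the stopping rule may
  look only at means of \<open>f1\<close> and \<open>f2\<close>. The shift enters later, through its
  finitely many nonzero cubes and a finite partition fitted to them. The obstacle of the vector case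
  is that a product of the sizes of the two bodies is too large a bound: the right side pairs the
  bodies, and it vanishes if they lie in orthogonal subspaces. For this reason the expansion vectors
  \<open>b i\<close> are taken inside the body of \<open>f1\<close>. The mean of
  \<open>b i \<bullet> f2\<close> in absolute value is then a value \<open>k \<bullet> h\<close>
  under the supremum in \<open>set_pair\<close>, while the dual vectors \<open>w i\<close> are
  bounded on the body by a constant that depends on the dimension only. With n the dimension of the
  target space there are 2 n scalar functions, and the threshold factor 4 n is twice their number.
  By Chebyshev's inequality at least half of the cube stays outside the stopping cubes, hence the
  sparseness constant 1/2.\<close>

lemma cube_left_mem: "0 < l \<Longrightarrow> a \<in> cube a l"
  by (simp add: cube_def)

text \<open>The right corner of a half-open cube is outside it; these points of the cube tend to it,
  so an inclusion of cubes bounds the right corners in the limit.\<close>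

lemma cube_mem_near_right:
  assumes "0 < l"
  shows "(\<chi> i. a$i + l * (1 - 1 / real (Suc k))) \<in> cube a l"
proof -
  have "1 - 1 / real (Suc k) < 1" "0 \<le> 1 - 1 / real (Suc k)" by simp_all
  then show ?thesis
    using assms by (simp add: cube_def del: of_nat_Suc)
qed

lemma cube_subset_bounds:
  fixes a b :: "real^'d"
  assumes "0 < l" "cube a l \<subseteq> cube b m"
  shows "b$i \<le> a$i" "a$i + l \<le> b$i + m"
proof -
  show "b$i \<le> a$i"
    using cube_left_mem[OF assms(1), of a] assms(2) by (auto simp: cube_def)
  have "a$i + l * (1 - 1 / real (Suc k)) < b$i + m" for k
  proof -
    have "(\<chi> i. a$i + l * (1 - 1 / real (Suc k))) \<in> cube b m"
      using cube_mem_near_right[OF assms(1)] assms(2) by blast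
    then show ?thesis by (simp add: cube_def del: of_nat_Suc)
  qed
  moreover have "(\<lambda>k. a$i + l * (1 - 1 / real (Suc k))) \<longlonglongrightarrow> a$i + l * (1 - 0)"
    by (intro tendsto_intros LIMSEQ_inverse_real_of_nat[unfolded inverse_eq_divide])
  ultimately have "a$i + l * (1 - 0) \<le> b$i + m"
    by (intro LIMSEQ_le_const2) (auto intro: less_imp_le)
  then show "a$i + l \<le> b$i + m" by simp
qed

text \<open>This gives the definite description in \<open>sidelen\<close> its value: a cube
  determines its corner and, index types being nonempty, its side length.\<close>

lemma cube_eq_iff:
  fixes a b :: "real^'d"
  assumes "0 < l" "0 < m"
  shows "cube a l = cube b m \<longleftrightarrow> a = b \<and> l = m"
proof
  assume eq: "cube a l = cube b m"
  have "a$i = b$i \<and> l = m" for i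
    using cube_subset_bounds[of l a b m i] cube_subset_bounds[of m b a l i] assms eq by auto
  then show "a = b \<and> l = m" by (auto simp: vec_eq_iff)
qed auto

lemma sidelen_cube: "0 < l \<Longrightarrow> sidelen (cube a l) = l"
  unfolding sidelen_def by (rule the_equality) (auto simp: cube_eq_iff)

lemma is_cubeE:
  assumes "is_cube Q"
  obtains a l where "0 < l" "Q = cube a l" "sidelen Q = l"
  using assms unfolding is_cube_def by (metis sidelen_cube)

lemma cube_lmeasurable_measure:
  fixes a :: "real^'d"
  assumes "0 < l"
  shows "cube a l \<in> lmeasurable" "measure lebesgue (cube a l) = l ^ CARD('d)"
proof -
  define b where "b = (\<chi> i. a$i + l)"
  have "cube a l \<in> sets borel"
    unfolding cube_def by measurable
  then have S: "cube a l \<in> sets lebesgue"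
    by auto
  have sub: "box a b \<subseteq> cube a l" "cube a l \<subseteq> cbox a b"
    by (auto simp: cube_def b_def mem_box_cart less_imp_le)
  show m: "cube a l \<in> lmeasurable"
    by (rule fmeasurableI2[OF _ sub(2) S]) auto
  have "measure lebesgue (box a b) = l ^ CARD('d)" "measure lebesgue (cbox a b) = l ^ CARD('d)"
  proof -
    show "measure lebesgue (cbox a b) = l ^ CARD('d)"
    proof -
      have "cbox a b \<noteq> {}" using assms by (simp add: b_def interval_ne_empty_cart)
      then show ?thesis by (simp add: content_cbox_cart b_def)
    qed
    then show "measure lebesgue (box a b) = l ^ CARD('d)"
      by (simp add: measure_lborel_box_eq measure_lborel_cbox_eq box_eq_empty)
  qed
  moreover have "measure lebesgue (box a b) \<le> measure lebesgue (cube a l)"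
    by (rule measure_mono_fmeasurable[OF sub(1) _ m]) auto
  moreover have "measure lebesgue (cube a l) \<le> measure lebesgue (cbox a b)"
    by (rule measure_mono_fmeasurable[OF sub(2) S]) auto
  ultimately show "measure lebesgue (cube a l) = l ^ CARD('d)" by simp
qed

lemma is_cube_lmeasurable: "is_cube Q \<Longrightarrow> Q \<in> lmeasurable"
  by (metis is_cube_def cube_lmeasurable_measure(1))

lemma is_cube_measure:
  fixes Q :: "(real^'d) set"
  shows "is_cube Q \<Longrightarrow> measure lebesgue Q = sidelen Q ^ CARD('d)"
  by (metis is_cubeE cube_lmeasurable_measure(2))

lemma is_cube_sidelen_pos: "is_cube Q \<Longrightarrow> 0 < sidelen Q"
  by (metis is_cubeE)

lemma is_cube_measure_pos: "is_cube Q \<Longrightarrow> 0 < measure lebesgue Q"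
  by (simp add: is_cube_measure is_cube_sidelen_pos)

lemma is_cube_nonempty: "is_cube Q \<Longrightarrow> Q \<noteq> {}"
  by (metis is_cubeE cube_left_mem empty_iff)

lemma is_cube_subset_sidelen:
  assumes "is_cube Q" "is_cube R" "Q \<subseteq> R"
  shows "sidelen Q \<le> sidelen R"
proof -
  obtain a l where a: "0 < l" "Q = cube a l" "sidelen Q = l" using assms(1) by (rule is_cubeE)
  obtain b m where b: "R = cube b m" "sidelen R = m" using assms(2) by (rule is_cubeE)
  have "cube a l \<subseteq> cube b m" using a b assms(3) by simp
  from cube_subset_bounds[OF a(1) this, of undefined] a(3) b(2) show ?thesis by linarith
qed

section \<open>Children and generations of descendants\<close>

lemma dyadic_childE:
  assumes "dyadic_child R Q"
  obtains a l e where "0 < l" "Q = cube a l" "\<And>i. e$i = 0 \<or> e$i = 1"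
    "R = cube (a + (l/2) *\<^sub>R e) (l/2)"
  using assms unfolding dyadic_child_def by fastforce

lemma dyadic_child_is_cube:
  assumes "dyadic_child R Q"
  shows "is_cube R" "is_cube Q"
proof -
  obtain a l e where *: "0 < l" "Q = cube a l" "R = cube (a + (l/2) *\<^sub>R e) (l/2)"
    using assms by (rule dyadic_childE) blast
  have "0 < l/2" using *(1) by simp
  then show "is_cube R" "is_cube Q" unfolding is_cube_def using * by blast+
qed

lemma dyadic_child_sidelen: "dyadic_child R Q \<Longrightarrow> sidelen R = sidelen Q / 2"
  by (elim dyadic_childE) (simp add: sidelen_cube)

lemma dyadic_child_subset:
  assumes "dyadic_child R Q"
  shows "R \<subseteq> Q"
proof -
  obtain a l e where *: "0 < l" "Q = cube a l" "\<And>i. e$i = 0 \<or> e$i = 1"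
    "R = cube (a + (l/2) *\<^sub>R e) (l/2)"
    using assms by (rule dyadic_childE) blast
  show ?thesis
  proof
    fix x assume "x \<in> R"
    then have "a$i \<le> x$i \<and> x$i < a$i + l" for i
      using *(1) *(3)[of i] unfolding *(4) cube_def by (auto dest!: spec[of _ i])
    then show "x \<in> Q" by (simp add: *(2) cube_def)
  qed
qed

lemma finite_dyadic_children: "finite {R::(real^'d) set. dyadic_child R Q}"
proof (cases "is_cube Q")
  case True
  then obtain a L where a: "0 < L" "Q = cube a L" by (rule is_cubeE)
  have "finite {e::real^'d. \<forall>i. e$i \<in> {0,1}}"
  proof -
    have "finite (vec_lambda ` (UNIV \<rightarrow>\<^sub>E {0,1::real}) :: (real^'d) set)"
      by (intro finite_imageI finite_PiE) auto
    moreover have "{e::real^'d. \<forall>i. e$i \<in> {0,1}} \<subseteq> vec_lambda ` (UNIV \<rightarrow>\<^sub>E {0,1::real})"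
    proof
      fix e :: "real^'d" assume "e \<in> {e. \<forall>i. e$i \<in> {0,1}}"
      then show "e \<in> vec_lambda ` (UNIV \<rightarrow>\<^sub>E {0,1::real})"
        by (intro image_eqI[of _ _ "\<lambda>i. e$i"]) auto
    qed
    ultimately show ?thesis by (rule finite_subset[rotated])
  qed
  moreover have "{R. dyadic_child R Q} \<subseteq>
      (\<lambda>e. cube (a + (L/2) *\<^sub>R e) (L/2)) ` {e. \<forall>i. e$i \<in> {0,1}}"
  proof
    fix R assume "R \<in> {R. dyadic_child R Q}"
    then have "dyadic_child R Q" by simp
    then obtain b l e where *: "0 < l" "Q = cube b l" "\<And>i. e$i = 0 \<or> e$i = 1"
      "R = cube (b + (l/2) *\<^sub>R e) (l/2)" by (rule dyadic_childE) blast
    then have "b = a" "l = L" using a cube_eq_iff[of L l a b] by auto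
    with * show "R \<in> (\<lambda>e. cube (a + (L/2) *\<^sub>R e) (L/2)) ` {e. \<forall>i. e$i \<in> {0,1}}"
      by auto
  qed
  ultimately show ?thesis using finite_surj by blast
next
  case False
  then have "{R. dyadic_child R Q} = {}" using dyadic_child_is_cube by auto
  then show ?thesis by simp
qed

lemma dyadic_children_disjoint:
  assumes "dyadic_child R Q" "dyadic_child R' Q" "x \<in> R" "x \<in> R'"
  shows "R = R'"
proof -
  obtain a l e where *: "0 < l" "Q = cube a l" "\<And>i. e$i = 0 \<or> e$i = 1"
    "R = cube (a + (l/2) *\<^sub>R e) (l/2)"
    using assms(1) by (rule dyadic_childE) blast
  obtain b m e' where **: "0 < m" "Q = cube b m" "\<And>i. e'$i = 0 \<or> e'$i = 1"
    "R' = cube (b + (m/2) *\<^sub>R e') (m/2)"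
    using assms(2) by (rule dyadic_childE) blast
  have [simp]: "b = a" "m = l" using * ** cube_eq_iff[of l m a b] by auto
  have "e$i = e'$i" for i
    using assms(3,4) *(1) *(3)[of i] **(3)[of i] unfolding *(4) **(4) cube_def
    by (auto dest!: spec[of _ i])
  then have "e = e'" by (simp add: vec_eq_iff)
  then show ?thesis using * ** by simp
qed

lemma dyadic_children_cover:
  assumes "is_cube Q" "x \<in> Q"
  shows "\<exists>R. dyadic_child R Q \<and> x \<in> R"
proof -
  obtain a l where l: "0 < l" "Q = cube a l" using assms(1) by (rule is_cubeE)
  define e where "e = (\<chi> i. if x$i < a$i + l/2 then 0 else (1::real))"
  have "x \<in> cube (a + (l/2) *\<^sub>R e) (l/2)"
    using assms(2) l unfolding l(2) cube_def e_def by (auto simp: add.commute)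
  moreover have "dyadic_child (cube (a + (l/2) *\<^sub>R e) (l/2)) Q"
    unfolding dyadic_child_def using l by (intro exI[of _ a] exI[of _ l] exI[of _ e]) (auto simp: e_def)
  ultimately show ?thesis by blast
qed

text \<open>Unlike \<open>dyadic_desc\<close>, this keeps the generation number, which can be read
  off the side length. Each generation of a cube is a finite partition of it.\<close>

primrec descs :: "nat \<Rightarrow> (real^'d) set \<Rightarrow> (real^'d) set set" where
  "descs 0 Q = {Q}"
| "descs (Suc k) Q = (\<Union>R\<in>descs k Q. {R'. dyadic_child R' R})"

lemma finite_descs: "finite (descs k Q)"
  by (induction k) (auto simp: finite_dyadic_children)

lemma descs_is_cube: "is_cube Q \<Longrightarrow> R \<in> descs k Q \<Longrightarrow> is_cube R"
  by (cases k) (auto dest: dyadic_child_is_cube)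

lemma descs_subset: "R \<in> descs k Q \<Longrightarrow> R \<subseteq> Q"
  by (induction k arbitrary: R) (auto dest!: dyadic_child_subset)

lemma descs_sidelen: "R \<in> descs k Q \<Longrightarrow> sidelen R = sidelen Q / 2^k"
  by (induction k arbitrary: R) (auto dest!: dyadic_child_sidelen)

lemma descs_disjoint:
  "R \<in> descs k Q \<Longrightarrow> R' \<in> descs k Q \<Longrightarrow> x \<in> R \<Longrightarrow> x \<in> R' \<Longrightarrow> R = R'"
proof (induction k arbitrary: R R')
  case (Suc k)
  then obtain T T' where T: "T \<in> descs k Q" "T' \<in> descs k Q" "dyadic_child R T" "dyadic_child R' T'"
    by auto
  then have "T = T'" using Suc dyadic_child_subset by blast
  then show ?case using T Suc.prems dyadic_children_disjoint by blast
qed auto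

lemma descs_cover: "is_cube Q \<Longrightarrow> x \<in> Q \<Longrightarrow> \<exists>R\<in>descs k Q. x \<in> R"
proof (induction k)
  case (Suc k)
  then obtain T where "T \<in> descs k Q" "x \<in> T" by auto
  moreover obtain R where "dyadic_child R T" "x \<in> R"
    using calculation dyadic_children_cover[of T x] descs_is_cube Suc.prems by blast
  ultimately show ?case by auto
qed auto

lemma descs_Union: "is_cube Q \<Longrightarrow> \<Union>(descs k Q) = Q"
  using descs_cover descs_subset by fast

lemma descs_add: "R \<in> descs (j + k) Q \<longleftrightarrow> (\<exists>T\<in>descs j Q. R \<in> descs k T)"
proof (induction k arbitrary: R)
  case (Suc k)
  have "R \<in> descs (j + Suc k) Q \<longleftrightarrow> (\<exists>S\<in>descs (j + k) Q. dyadic_child R S)" by auto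
  also have "\<dots> \<longleftrightarrow> (\<exists>S. \<exists>T\<in>descs j Q. S \<in> descs k T \<and> dyadic_child R S)"
    using Suc.IH by blast
  also have "\<dots> \<longleftrightarrow> (\<exists>T\<in>descs j Q. R \<in> descs (Suc k) T)" by auto
  finally show ?case .
qed simp

lemma dyadic_desc_iff_descs: "dyadic_desc R Q \<longleftrightarrow> (\<exists>k. R \<in> descs k Q)"
proof
  assume "dyadic_desc R Q"
  then show "\<exists>k. R \<in> descs k Q"
    unfolding dyadic_desc_def
  proof (induction rule: converse_rtranclp_induct)
    case base
    show ?case by (rule exI[of _ 0]) simp
  next
    case (step y z)
    then obtain k where "z \<in> descs k Q" by blast
    with step have "y \<in> descs (Suc k) Q" by auto
    then show ?case ..
  qed
next
  have "dyadic_desc R Q" if "R \<in> descs k Q" for k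
    using that unfolding dyadic_desc_def
    by (induction k arbitrary: R) (auto intro: converse_rtranclp_into_rtranclp)
  then show "\<exists>k. R \<in> descs k Q \<Longrightarrow> dyadic_desc R Q" by blast
qed

lemma descs_measure:
  assumes "is_cube Q" "(R::(real^'d) set) \<in> descs k Q"
  shows "measure lebesgue Q = (2^k)^CARD('d) * measure lebesgue R"
  using assms by (simp add: is_cube_measure descs_is_cube descs_sidelen power_divide)

declare descs.simps(2)[simp del]

section \<open>Nesting in a dyadic lattice\<close>

context
  fixes D :: "(real^'d) set set"
  assumes D: "dyadic_lattice D"
begin

lemma lattice_is_cube: "Q \<in> D \<Longrightarrow> is_cube Q"
  using D by (simp add: dyadic_lattice_def)

lemma lattice_descs: "Q \<in> D \<Longrightarrow> R \<in> descs k Q \<Longrightarrow> R \<in> D"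
proof (induction k arbitrary: R)
  case (Suc k)
  then show ?case using D unfolding dyadic_lattice_def by (auto simp: descs.simps(2))
qed auto

text \<open>Both cubes descend from a common ancestor. The ancestor of \<open>R\<close> in the
  generation of \<open>Q\<close> meets \<open>Q\<close>, and distinct cubes of one generation are
  disjoint, so it is \<open>Q\<close>.\<close>

lemma lattice_nested_descs:
  assumes "Q \<in> D" "R \<in> D" "Q \<inter> R \<noteq> {}" "sidelen R \<le> sidelen Q"
  shows "\<exists>k. R \<in> descs k Q"
proof -
  obtain T j k where T: "T \<in> D" "Q \<in> descs j T" "R \<in> descs k T"
    using D assms(1,2) unfolding dyadic_lattice_def dyadic_desc_iff_descs by meson
  have "0 < sidelen T" using T lattice_is_cube is_cube_sidelen_pos by blast
  then have "(2::real)^j \<le> 2^k"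
    using assms(4) descs_sidelen[OF T(2)] descs_sidelen[OF T(3)] by (simp add: field_simps)
  then have "j \<le> k" by simp
  then obtain Q' where Q': "Q' \<in> descs j T" "R \<in> descs (k - j) Q'"
    using T(3) descs_add[of R j "k - j" T] by auto
  obtain x where "x \<in> Q" "x \<in> R" using assms(3) by blast
  then have "Q' = Q" using Q' T descs_disjoint descs_subset by blast
  then show ?thesis using Q' by blast
qed

lemma lattice_nested:
  assumes "Q \<in> D" "R \<in> D" "Q \<inter> R \<noteq> {}" "sidelen R \<le> sidelen Q"
  shows "R \<subseteq> Q"
  using lattice_nested_descs[OF assms] descs_subset by blast

lemma lattice_subset_descs:
  assumes "Q \<in> D" "R \<in> D" "R \<subseteq> Q"
  shows "\<exists>k. R \<in> descs k Q"
proof (rule lattice_nested_descs[OF assms(1,2)])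
  show "Q \<inter> R \<noteq> {}"
    using is_cube_nonempty[OF lattice_is_cube[OF assms(2)]] assms(3) by auto
  show "sidelen R \<le> sidelen Q"
    using assms by (intro is_cube_subset_sidelen lattice_is_cube)
qed

lemma lattice_trichotomy:
  assumes "Q \<in> D" "R \<in> D"
  shows "R \<subseteq> Q \<or> Q \<subseteq> R \<or> Q \<inter> R = {}"
proof (cases "sidelen R \<le> sidelen Q")
  case True
  then show ?thesis using lattice_nested[OF assms] by auto
next
  case False
  then show ?thesis using lattice_nested[OF assms(2,1)] by auto
qed

text \<open>The source of the linear dependence on the complexity. Lattice cubes containing
  \<open>P\<close> form a chain, so side lengths tell them apart, and the second condition admits
  only the lengths \<open>2^k * sidelen P\<close> with \<open>k \<le> m\<close>.\<close>

lemma card_ancestors_le: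
  assumes "P \<in> D" "finite F" "F \<subseteq> D"
  shows "card {Q\<in>F. P \<subseteq> Q \<and> \<not> sidelen P < sidelen Q / 2^m} \<le> m + 1"
proof -
  let ?A = "{Q\<in>F. P \<subseteq> Q \<and> \<not> sidelen P < sidelen Q / 2^m}"
  have P: "P \<noteq> {}" "0 < sidelen P"
    using is_cube_nonempty is_cube_sidelen_pos lattice_is_cube[OF assms(1)] by auto
  have inj: "inj_on sidelen ?A"
  proof (rule inj_onI)
    fix Q R assume *: "Q \<in> ?A" "R \<in> ?A" and eq: "sidelen Q = sidelen R"
    then have "Q \<inter> R \<noteq> {}" "R \<inter> Q \<noteq> {}" "Q \<in> D" "R \<in> D" using P(1) assms(3) by auto
    then show "Q = R"
      using lattice_nested[of Q R] lattice_nested[of R Q] eq by simp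
  qed
  have sub: "sidelen ` ?A \<subseteq> (\<lambda>k. 2^k * sidelen P) ` {..m}"
  proof
    fix y assume "y \<in> sidelen ` ?A"
    then obtain Q where Q: "Q \<in> F" "P \<subseteq> Q" "\<not> sidelen P < sidelen Q / 2^m" "y = sidelen Q" by auto
    then obtain k where k: "P \<in> descs k Q" using lattice_subset_descs assms by blast
    have y: "y = 2^k * sidelen P" using descs_sidelen[OF k] Q by simp
    then have "(2::real)^k \<le> 2^m" using Q P by (simp add: field_simps)
    then have "k \<le> m" by simp
    then show "y \<in> (\<lambda>k. 2^k * sidelen P) ` {..m}" using y by auto
  qed
  have "card ?A = card (sidelen ` ?A)" by (rule card_image[OF inj, symmetric])
  also have "\<dots> \<le> card ((\<lambda>k. 2^k * sidelen P) ` {..m})"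
    by (rule card_mono[OF _ sub]) simp
  also have "\<dots> \<le> card {..m}" by (rule card_image_le) simp
  also have "\<dots> = m + 1" by simp
  finally show ?thesis .
qed

end

section \<open>The form of a single cube\<close>

text \<open>\<open>shift_form\<close> integrates over a product of two completed measures, so Fubini
  is needed for \<open>lebesgue\<close>. A countable cover for \<open>lborel\<close> still works, as
  completion leaves the measure of Borel sets unchanged.\<close>

lemma sigma_finite_lebesgue: "sigma_finite_measure (lebesgue :: 'a::euclidean_space measure)"
proof
  obtain A :: "'a set set" where A: "countable A" "A \<subseteq> sets lborel" "\<Union>A = space lborel"
    "\<forall>a\<in>A. emeasure lborel a \<noteq> \<infinity>"
    using lborel.sigma_finite_countable by blast
  show "\<exists>A. countable A \<and> A \<subseteq> sets (lebesgue :: 'a measure) \<and> \<Union>A = space lebesgue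
      \<and> (\<forall>a\<in>A. emeasure lebesgue a \<noteq> \<infinity>)"
  proof (intro exI[of _ A] conjI ballI)
    show "A \<subseteq> sets lebesgue" using A(2) by auto
    fix a assume "a \<in> A"
    then show "emeasure lebesgue a \<noteq> \<infinity>" using A(2,4) by (subst emeasure_completion) auto
  qed (use A in auto)
qed

context pair_sigma_finite
begin

lemma integrable_pair_mult:
  fixes u :: "'a \<Rightarrow> real" and v :: "'b \<Rightarrow> real"
  assumes [measurable]: "integrable M1 u" "integrable M2 v"
  shows "integrable (M1 \<Otimes>\<^sub>M M2) (\<lambda>(x,y). u x * v y)"
proof (rule Fubini_integrable)
  show "(\<lambda>(x,y). u x * v y) \<in> borel_measurable (M1 \<Otimes>\<^sub>M M2)" by measurable
  show "integrable M1 (\<lambda>x. \<integral>y. norm (case (x, y) of (x, y) \<Rightarrow> u x * v y) \<partial>M2)"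
    using assms by (simp add: abs_mult)
  show "AE x in M1. integrable M2 (\<lambda>y. case (x, y) of (x, y) \<Rightarrow> u x * v y)"
    using assms by simp
qed

lemma integral_pair_mult:
  fixes u :: "'a \<Rightarrow> real" and v :: "'b \<Rightarrow> real"
  assumes "integrable M1 u" "integrable M2 v"
  shows "(\<integral>(x,y). u x * v y \<partial>(M1 \<Otimes>\<^sub>M M2)) = integral\<^sup>L M1 u * integral\<^sup>L M2 v"
  using integral_fst'[OF integrable_pair_mult[OF assms]] by simp

end

interpretation lebesgue_pair: pair_sigma_finite
  "lebesgue :: 'a::euclidean_space measure" "lebesgue :: 'b::euclidean_space measure"
  by (intro pair_sigma_finite.intro sigma_finite_lebesgue)

definition cube_form ::
  "((real^'d) set \<Rightarrow> real^'d \<Rightarrow> real^'d \<Rightarrow> real) \<Rightarrow> (real^'d) set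
     \<Rightarrow> (real^'d \<Rightarrow> real) \<Rightarrow> (real^'d \<Rightarrow> real) \<Rightarrow> real" where
  "cube_form s Q u v = integral\<^sup>L (lebesgue \<Otimes>\<^sub>M lebesgue)
     (\<lambda>(x1,x2). indicator (Q \<times> Q) (x1,x2) * s Q x1 x2 * u x1 * v x2)"

definition nz_cubes where
  "nz_cubes s QQ = {Q\<in>QQ. \<exists>x1\<in>Q. \<exists>x2\<in>Q. s Q x1 x2 \<noteq> 0}"

lemma shift_form_eq: "shift_form QQ s u v = (\<Sum>Q\<in>nz_cubes s QQ. cube_form s Q u v)"
  unfolding shift_form_def nz_cubes_def cube_form_def ..

lemma sum_indicator_partition:
  fixes F :: "'a set \<Rightarrow> real"
  assumes "finite A" "R \<in> A" "x \<in> R" "\<And>R'. R' \<in> A \<Longrightarrow> x \<in> R' \<Longrightarrow> R' = R"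
  shows "(\<Sum>R'\<in>A. indicator R' x * F R') = F R"
proof -
  have "indicator R' x * F R' = (if R' = R then F R' else 0)" if "R' \<in> A" for R'
    using assms(3) assms(4)[OF that] by (cases "x \<in> R'") auto
  then have "(\<Sum>R'\<in>A. indicator R' x * F R') = (\<Sum>R'\<in>A. if R' = R then F R' else 0)"
    by (rule sum.cong[OF refl])
  then show ?thesis using assms(1,2) by simp
qed

lemma integrable_indicator_times:
  fixes u :: "'a \<Rightarrow> real"
  shows "R \<in> sets M \<Longrightarrow> integrable M u \<Longrightarrow> integrable M (\<lambda>x. indicator R x * u x)"
  using integrable_mult_indicator[of R M u] by simp

lemma dyadic_shift_finite: "dyadic_shift D m1 m2 s \<Longrightarrow> finite (nz_cubes s D)"
  by (simp add: dyadic_shift_def nz_cubes_def)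

lemma dyadic_shift_bound:
  "dyadic_shift D m1 m2 s \<Longrightarrow> Q \<in> D \<Longrightarrow> x \<in> Q \<Longrightarrow> y \<in> Q \<Longrightarrow> \<bar>s Q x y\<bar> \<le> 1 / measure lebesgue Q"
  by (simp add: dyadic_shift_def)

lemma dyadic_shift_L2:
  "dyadic_shift D m1 m2 s \<Longrightarrow> QQ \<subseteq> D \<Longrightarrow> L2_fun u \<Longrightarrow> L2_fun v \<Longrightarrow>
    \<bar>shift_form QQ s u v\<bar> \<le> L2_norm u * L2_norm v"
  by (simp add: dyadic_shift_def)

lemma dyadic_shift_const1:
  "dyadic_shift D m1 m2 s \<Longrightarrow> Q \<in> D \<Longrightarrow> R \<in> D \<Longrightarrow> R \<subseteq> Q \<Longrightarrow> sidelen R < sidelen Q / 2^m1 \<Longrightarrow>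
    y \<in> Q \<Longrightarrow> x \<in> R \<Longrightarrow> x' \<in> R \<Longrightarrow> s Q x y = s Q x' y"
  unfolding dyadic_shift_def by meson

lemma dyadic_shift_const2:
  "dyadic_shift D m1 m2 s \<Longrightarrow> Q \<in> D \<Longrightarrow> R \<in> D \<Longrightarrow> R \<subseteq> Q \<Longrightarrow> sidelen R < sidelen Q / 2^m2 \<Longrightarrow>
    x \<in> Q \<Longrightarrow> y \<in> R \<Longrightarrow> y' \<in> R \<Longrightarrow> s Q x y = s Q x y'"
  unfolding dyadic_shift_def by meson

text \<open>The kernel is constant on products of descendants, so the form of one cube is a finite sum
  of products of integrals.\<close>

lemma cube_form_descs:
  fixes D :: "(real^'d) set set"
  assumes D: "dyadic_lattice D" and s: "dyadic_shift D m1 m2 s" and Q: "Q \<in> D"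
  obtains c where
    "\<And>R1 R2. R1 \<in> descs (Suc m1) Q \<Longrightarrow> R2 \<in> descs (Suc m2) Q \<Longrightarrow> \<bar>c R1 R2\<bar> \<le> 1 / measure lebesgue Q"
    "\<And>u v. integrable lebesgue u \<Longrightarrow> integrable lebesgue v \<Longrightarrow>
      cube_form s Q u v = (\<Sum>R1\<in>descs (Suc m1) Q. \<Sum>R2\<in>descs (Suc m2) Q.
        c R1 R2 * ((LINT x:R1|lebesgue. u x) * (LINT x:R2|lebesgue. v x)))"
proof -
  define pt where "pt R = (SOME x::real^'d. x \<in> R)" for R
  \<comment> \<open>Kernel values at arbitrary sample points. They do not involve \<open>u\<close>
    and \<open>v\<close>, so bilinearity and cancellation can be read off the resulting
    formula.\<close>
  define c where "c R1 R2 = s Q (pt R1) (pt R2)" for R1 R2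
  have cQ: "is_cube Q" using lattice_is_cube[OF D Q] .
  have pt: "pt R \<in> R" if "R \<in> descs k Q" for R k
    unfolding pt_def by (rule someI_ex) (use is_cube_nonempty[OF descs_is_cube[OF cQ that]] in blast)
  \<comment> \<open>One generation beyond \<open>m\<close>: constancy is granted only for side
    lengths strictly below \<open>sidelen Q / 2^m\<close>.\<close>
  have len: "sidelen R < sidelen Q / 2^m" if "R \<in> descs (Suc m) Q" for R m
    using descs_sidelen[OF that] is_cube_sidelen_pos[OF cQ] by (simp add: field_simps)
  have c_eq: "s Q x1 x2 = c R1 R2"
    if "R1 \<in> descs (Suc m1) Q" "R2 \<in> descs (Suc m2) Q" "x1 \<in> R1" "x2 \<in> R2" for R1 R2 x1 x2
  proof -
    have R: "R1 \<in> D" "R2 \<in> D" "R1 \<subseteq> Q" "R2 \<subseteq> Q"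
      using lattice_descs[OF D Q] descs_subset that(1,2) by blast+
    have "s Q x1 x2 = s Q (pt R1) x2"
      by (rule dyadic_shift_const1[OF s Q R(1,3) len[OF that(1)] _ that(3) pt[OF that(1)]])
        (use R that in blast)
    also have "\<dots> = s Q (pt R1) (pt R2)"
      by (rule dyadic_shift_const2[OF s Q R(2,4) len[OF that(2)] _ that(4) pt[OF that(2)]])
        (use R pt[OF that(1)] in blast)
    finally show ?thesis by (simp add: c_def)
  qed
  have meas: "R \<in> sets lebesgue" if "R \<in> descs k Q" for R k
    using is_cube_lmeasurable[OF descs_is_cube[OF cQ that]] by auto
  show ?thesis
  proof (rule that[of c])
    fix R1 R2 assume R: "R1 \<in> descs (Suc m1) Q" "R2 \<in> descs (Suc m2) Q"
    then have "pt R1 \<in> Q" "pt R2 \<in> Q" using pt descs_subset by blast+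
    then show "\<bar>c R1 R2\<bar> \<le> 1 / measure lebesgue Q"
      unfolding c_def by (rule dyadic_shift_bound[OF s Q])
  next
    fix u v :: "real^'d \<Rightarrow> real" assume uv: "integrable lebesgue u" "integrable lebesgue v"
    let ?U = "\<lambda>R x. indicator R x * u x" and ?V = "\<lambda>R x. indicator R x * v x"
    \<comment> \<open>\<open>dyadic_shift\<close> says nothing about measurability of the kernel;
      this pointwise identity supplies it, by writing the integrand as a finite sum of integrable
      products.\<close>
    have eq: "indicator (Q \<times> Q) (x1,x2) * s Q x1 x2 * u x1 * v x2
        = (\<Sum>R1\<in>descs (Suc m1) Q. \<Sum>R2\<in>descs (Suc m2) Q. c R1 R2 * (?U R1 x1 * ?V R2 x2))" for x1 x2
    proof (cases "x1 \<in> Q \<and> x2 \<in> Q")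
      case True
      then obtain R1 R2 where R: "R1 \<in> descs (Suc m1) Q" "R2 \<in> descs (Suc m2) Q" "x1 \<in> R1" "x2 \<in> R2"
        using descs_cover[OF cQ] by metis
      have "(\<Sum>R1\<in>descs (Suc m1) Q. \<Sum>R2\<in>descs (Suc m2) Q. c R1 R2 * (?U R1 x1 * ?V R2 x2))
        = (\<Sum>R1\<in>descs (Suc m1) Q. indicator R1 x1 *
             (\<Sum>R2\<in>descs (Suc m2) Q. indicator R2 x2 * (c R1 R2 * u x1 * v x2)))"
        by (simp only: sum_distrib_left ac_simps)
      also have "\<dots> = (\<Sum>R2\<in>descs (Suc m2) Q. indicator R2 x2 * (c R1 R2 * u x1 * v x2))"
        using R descs_disjoint by (intro sum_indicator_partition finite_descs) blast+
      also have "\<dots> = c R1 R2 * u x1 * v x2"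
        using R descs_disjoint by (intro sum_indicator_partition finite_descs) blast+
      finally show ?thesis using True c_eq[OF R] by simp
    next
      case False
      then have "(\<Sum>R1\<in>descs (Suc m1) Q. \<Sum>R2\<in>descs (Suc m2) Q. c R1 R2 * (?U R1 x1 * ?V R2 x2)) = 0"
        using descs_subset[of _ _ Q] by (intro sum.neutral ballI) (auto simp: indicator_def)
      then show ?thesis using False by (auto simp: indicator_def)
    qed
    have int: "integrable (lebesgue \<Otimes>\<^sub>M lebesgue) (\<lambda>(x,y). ?U R1 x * ?V R2 y)"
      "(\<integral>(x,y). ?U R1 x * ?V R2 y \<partial>(lebesgue \<Otimes>\<^sub>M lebesgue))
        = (LINT x:R1|lebesgue. u x) * (LINT x:R2|lebesgue. v x)"
      if "R1 \<in> descs (Suc m1) Q" "R2 \<in> descs (Suc m2) Q" for R1 R2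
    proof -
      have i: "integrable lebesgue (?U R1)" "integrable lebesgue (?V R2)"
        using that uv meas by (auto intro!: integrable_indicator_times)
      show "integrable (lebesgue \<Otimes>\<^sub>M lebesgue) (\<lambda>(x,y). ?U R1 x * ?V R2 y)"
        by (rule lebesgue_pair.integrable_pair_mult[OF i])
      show "(\<integral>(x,y). ?U R1 x * ?V R2 y \<partial>(lebesgue \<Otimes>\<^sub>M lebesgue))
        = (LINT x:R1|lebesgue. u x) * (LINT x:R2|lebesgue. v x)"
        using lebesgue_pair.integral_pair_mult[OF i] by (simp add: set_lebesgue_integral_def)
    qed
    have "cube_form s Q u v = (\<integral>z. (\<Sum>R1\<in>descs (Suc m1) Q. \<Sum>R2\<in>descs (Suc m2) Q.
        c R1 R2 * (case z of (x,y) \<Rightarrow> ?U R1 x * ?V R2 y)) \<partial>(lebesgue \<Otimes>\<^sub>M lebesgue))"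
      unfolding cube_form_def by (intro Bochner_Integration.integral_cong refl) (simp only: eq case_prod_beta)
    also have "\<dots> = (\<Sum>R1\<in>descs (Suc m1) Q. \<Sum>R2\<in>descs (Suc m2) Q.
        \<integral>z. c R1 R2 * (case z of (x,y) \<Rightarrow> ?U R1 x * ?V R2 y) \<partial>(lebesgue \<Otimes>\<^sub>M lebesgue))"
      using int(1)
      by (subst Bochner_Integration.integral_sum)
        (auto intro!: sum.cong Bochner_Integration.integral_sum Bochner_Integration.integrable_sum
           integrable_mult_right)
    also have "\<dots> = (\<Sum>R1\<in>descs (Suc m1) Q. \<Sum>R2\<in>descs (Suc m2) Q.
        c R1 R2 * ((LINT x:R1|lebesgue. u x) * (LINT x:R2|lebesgue. v x)))"
      by (intro sum.cong refl, subst integral_mult_right_zero) (use int(2) in simp)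
    finally show "cube_form s Q u v = (\<Sum>R1\<in>descs (Suc m1) Q. \<Sum>R2\<in>descs (Suc m2) Q.
        c R1 R2 * ((LINT x:R1|lebesgue. u x) * (LINT x:R2|lebesgue. v x)))" .
  qed
qed

section \<open>Integrals over finite disjoint families\<close>

lemma set_integrable_of_integrable:
  fixes u :: "'a \<Rightarrow> 'b::{banach,second_countable_topology}"
  shows "R \<in> sets M \<Longrightarrow> integrable M u \<Longrightarrow> set_integrable M R u"
  by (simp add: set_integrable_def integrable_mult_indicator)

lemma set_integral_abs_le:
  fixes u :: "'a \<Rightarrow> real"
  shows "\<bar>LINT x:R|M. u x\<bar> \<le> (LINT x:R|M. \<bar>u x\<bar>)"
  using integral_norm_bound[of M "\<lambda>x. indicator R x *\<^sub>R u x"]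
  by (simp add: set_lebesgue_integral_def abs_mult)

lemma set_integral_abs_nonneg:
  fixes u :: "'a \<Rightarrow> real"
  shows "0 \<le> (LINT x:R|M. \<bar>u x\<bar>)"
  by (simp add: set_lebesgue_integral_def)

lemma set_integral_abs_mono_set:
  fixes u :: "'a \<Rightarrow> real"
  assumes "R \<in> sets M" "S \<in> sets M" "integrable M u" "R \<subseteq> S"
  shows "(LINT x:R|M. \<bar>u x\<bar>) \<le> (LINT x:S|M. \<bar>u x\<bar>)"
  unfolding set_lebesgue_integral_def
  using assms by (intro integral_mono integrable_mult_indicator integrable_abs) (auto simp: indicator_def)

lemma sum_set_integral_disjoint:
  fixes u :: "'a \<Rightarrow> real"
  assumes "finite A" "A \<subseteq> sets M" "integrable M u"
    and "\<And>R R' x. R \<in> A \<Longrightarrow> R' \<in> A \<Longrightarrow> x \<in> R \<Longrightarrow> x \<in> R' \<Longrightarrow> R = R'"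
  shows "(\<Sum>R\<in>A. LINT x:R|M. u x) = (LINT x:\<Union>A|M. u x)"
proof -
  have "disjoint_family_on (\<lambda>R. R) A"
    unfolding disjoint_family_on_def using assms(4) by blast
  then have "(LINT x:(\<Union>R\<in>A. R)|M. u x) = (\<Sum>R\<in>A. LINT x:R|M. u x)"
    using assms(1-3) by (intro set_integral_finite_Union set_integrable_of_integrable) auto
  then show ?thesis by simp
qed

lemma sum_abs_integral_descs_le:
  fixes u :: "real^'d \<Rightarrow> real"
  assumes "is_cube Q" "integrable lebesgue u"
  shows "(\<Sum>R\<in>descs k Q. \<bar>LINT x:R|lebesgue. u x\<bar>) \<le> (LINT x:Q|lebesgue. \<bar>u x\<bar>)"
proof -
  have "(\<Sum>R\<in>descs k Q. \<bar>LINT x:R|lebesgue. u x\<bar>) \<le> (\<Sum>R\<in>descs k Q. LINT x:R|lebesgue. \<bar>u x\<bar>)"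
    by (intro sum_mono set_integral_abs_le)
  also have "\<dots> = (LINT x:\<Union>(descs k Q)|lebesgue. \<bar>u x\<bar>)"
  proof (intro sum_set_integral_disjoint finite_descs)
    show "descs k Q \<subseteq> sets lebesgue"
      using is_cube_lmeasurable[OF descs_is_cube[OF assms(1)]] by blast
    show "R = R'" if "R \<in> descs k Q" "R' \<in> descs k Q" "x \<in> R" "x \<in> R'" for R R' x
      using descs_disjoint[OF that] .
  qed (use assms in auto)
  finally show ?thesis using descs_Union[OF assms(1)] by simp
qed

section \<open>Bilinearity, size and cancellation of the form of one cube\<close>

context
  fixes D :: "(real^'d) set set" and m1 m2 s
  assumes D: "dyadic_lattice D" and s: "dyadic_shift D m1 m2 s"
begin

text \<open>In the finite formula only integrals of the functions themselves over cubes remain, and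
  these are additive.\<close>

lemma cube_form_add_left:
  assumes "Q \<in> D" "integrable lebesgue u" "integrable lebesgue u'" "integrable lebesgue v"
  shows "cube_form s Q (\<lambda>x. u x + u' x) v = cube_form s Q u v + cube_form s Q u' v"
proof -
  obtain c where c: "\<And>u v. integrable lebesgue u \<Longrightarrow> integrable lebesgue v \<Longrightarrow>
      cube_form s Q u v = (\<Sum>R1\<in>descs (Suc m1) Q. \<Sum>R2\<in>descs (Suc m2) Q.
        c R1 R2 * ((LINT x:R1|lebesgue. u x) * (LINT x:R2|lebesgue. v x)))"
    by (rule cube_form_descs[OF D s assms(1)]) blast
  have "(LINT x:R|lebesgue. u x + u' x) = (LINT x:R|lebesgue. u x) + (LINT x:R|lebesgue. u' x)"
    if "R \<in> descs (Suc m1) Q" for R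
    using is_cube_lmeasurable[OF lattice_is_cube[OF D lattice_descs[OF D assms(1) that]]] assms
    by (intro set_integral_add set_integrable_of_integrable) auto
  then show ?thesis
    using assms by (simp add: c distrib_left distrib_right sum.distrib cong: sum.cong)
qed

lemma cube_form_add_right:
  assumes "Q \<in> D" "integrable lebesgue u" "integrable lebesgue v" "integrable lebesgue v'"
  shows "cube_form s Q u (\<lambda>x. v x + v' x) = cube_form s Q u v + cube_form s Q u v'"
proof -
  obtain c where c: "\<And>u v. integrable lebesgue u \<Longrightarrow> integrable lebesgue v \<Longrightarrow>
      cube_form s Q u v = (\<Sum>R1\<in>descs (Suc m1) Q. \<Sum>R2\<in>descs (Suc m2) Q.
        c R1 R2 * ((LINT x:R1|lebesgue. u x) * (LINT x:R2|lebesgue. v x)))"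
    by (rule cube_form_descs[OF D s assms(1)]) blast
  have "(LINT x:R|lebesgue. v x + v' x) = (LINT x:R|lebesgue. v x) + (LINT x:R|lebesgue. v' x)"
    if "R \<in> descs (Suc m2) Q" for R
    using is_cube_lmeasurable[OF lattice_is_cube[OF D lattice_descs[OF D assms(1) that]]] assms
    by (intro set_integral_add set_integrable_of_integrable) auto
  then show ?thesis
    using assms by (simp add: c distrib_left distrib_right sum.distrib cong: sum.cong)
qed

lemma cube_form_zero: "cube_form s Q (\<lambda>x. 0) v = 0" "cube_form s Q u (\<lambda>x. 0) = 0"
  by (simp_all add: cube_form_def case_prod_unfold)

lemma cube_form_sum_left:
  assumes "Q \<in> D" "finite A" "\<And>i. i \<in> A \<Longrightarrow> integrable lebesgue (u i)" "integrable lebesgue v"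
  shows "cube_form s Q (\<lambda>x. \<Sum>i\<in>A. u i x) v = (\<Sum>i\<in>A. cube_form s Q (u i) v)"
  using assms(2,3)
proof (induction A)
  case (insert i A)
  then have "cube_form s Q (\<lambda>x. u i x + (\<Sum>i\<in>A. u i x)) v
      = cube_form s Q (u i) v + cube_form s Q (\<lambda>x. \<Sum>i\<in>A. u i x) v"
    using assms by (intro cube_form_add_left) auto
  with insert show ?case by simp
qed (simp add: cube_form_zero)

lemma cube_form_sum_right:
  assumes "Q \<in> D" "finite A" "\<And>i. i \<in> A \<Longrightarrow> integrable lebesgue (v i)" "integrable lebesgue u"
  shows "cube_form s Q u (\<lambda>x. \<Sum>i\<in>A. v i x) = (\<Sum>i\<in>A. cube_form s Q u (v i))"
  using assms(2,3)
proof (induction A)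
  case (insert i A)
  then have "cube_form s Q u (\<lambda>x. v i x + (\<Sum>i\<in>A. v i x))
      = cube_form s Q u (v i) + cube_form s Q u (\<lambda>x. \<Sum>i\<in>A. v i x)"
    using assms by (intro cube_form_add_right) auto
  with insert show ?case by simp
qed (simp add: cube_form_zero)

lemma cube_form_abs_le:
  assumes "Q \<in> D" "integrable lebesgue u" "integrable lebesgue v"
  shows "\<bar>cube_form s Q u v\<bar>
    \<le> (LINT x:Q|lebesgue. \<bar>u x\<bar>) * (LINT x:Q|lebesgue. \<bar>v x\<bar>) / measure lebesgue Q"
proof -
  obtain c where c: "\<And>R1 R2. R1 \<in> descs (Suc m1) Q \<Longrightarrow> R2 \<in> descs (Suc m2) Q
      \<Longrightarrow> \<bar>c R1 R2\<bar> \<le> 1 / measure lebesgue Q"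
    and eq: "cube_form s Q u v = (\<Sum>R1\<in>descs (Suc m1) Q. \<Sum>R2\<in>descs (Suc m2) Q.
        c R1 R2 * ((LINT x:R1|lebesgue. u x) * (LINT x:R2|lebesgue. v x)))"
    by (rule cube_form_descs[OF D s assms(1)]) (use assms(2,3) in blast)
  have "\<bar>cube_form s Q u v\<bar> \<le> (\<Sum>R1\<in>descs (Suc m1) Q. \<Sum>R2\<in>descs (Suc m2) Q.
        (1 / measure lebesgue Q) * (\<bar>LINT x:R1|lebesgue. u x\<bar> * \<bar>LINT x:R2|lebesgue. v x\<bar>))"
    unfolding eq using c
    by (intro order_trans[OF sum_abs] sum_mono, unfold abs_mult) (intro mult_right_mono, auto)
  also have "\<dots> = (1 / measure lebesgue Q) *
     ((\<Sum>R1\<in>descs (Suc m1) Q. \<bar>LINT x:R1|lebesgue. u x\<bar>) * (\<Sum>R2\<in>descs (Suc m2) Q. \<bar>LINT x:R2|lebesgue. v x\<bar>))"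
    unfolding sum_product by (simp only: sum_distrib_left)
  also have "\<dots> \<le> (1 / measure lebesgue Q) *
     ((LINT x:Q|lebesgue. \<bar>u x\<bar>) * (LINT x:Q|lebesgue. \<bar>v x\<bar>))"
    using assms lattice_is_cube[OF D]
    by (intro mult_left_mono mult_mono sum_abs_integral_descs_le sum_nonneg set_integral_abs_nonneg) auto
  finally show ?thesis by (simp add: mult.commute)
qed

text \<open>If the cell \<open>R\<close> meets \<open>P\<close>, then \<open>P\<close> is a
  descendant of \<open>Q\<close>; being shorter than generation \<open>m\<close>, it belongs to
  generation \<open>m + 1\<close> or a later one and so lies in \<open>R\<close>. The integral over
  \<open>R\<close> is then the whole integral of \<open>u\<close>.\<close>

lemma set_integral_small_cube_zero:
  fixes u :: "real^'d \<Rightarrow> real"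
  assumes "Q \<in> D" "P \<in> D" "\<And>x. x \<notin> P \<Longrightarrow> u x = 0" "integral\<^sup>L lebesgue u = 0"
    and "sidelen P < sidelen Q / 2^m" "R \<in> descs (Suc m) Q"
  shows "(LINT x:R|lebesgue. u x) = 0"
proof (cases "P \<inter> R = {}")
  case True
  then have "indicator R x *\<^sub>R u x = 0" for x using assms(3)[of x] by (auto simp: indicator_def)
  then show ?thesis unfolding set_lebesgue_integral_def by (simp only: Bochner_Integration.integral_zero)
next
  case False
  have RD: "R \<in> D" and RQ: "R \<subseteq> Q" using assms lattice_descs[OF D] descs_subset by blast+
  have pos: "0 < sidelen Q" using assms lattice_is_cube[OF D] is_cube_sidelen_pos by blast
  then have "sidelen Q / 2^m \<le> sidelen Q" by (simp add: field_simps)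
  then have "sidelen P \<le> sidelen Q" using assms(5) by linarith
  then obtain k where k: "P \<in> descs k Q"
    using lattice_nested_descs[OF D assms(1,2)] False RQ by blast
  then have "sidelen Q / 2^k < sidelen Q / 2^m" using descs_sidelen[OF k] assms(5) by simp
  then have "(2::real)^m < 2^k" using pos by (simp add: field_simps)
  then have "Suc m \<le> k" by simp
  then have "(2::real)^Suc m \<le> 2^k" by (intro power_increasing) auto
  then have "sidelen P \<le> sidelen R"
    using descs_sidelen[OF k] descs_sidelen[OF assms(6)] pos by (simp add: divide_left_mono)
  then have "P \<subseteq> R" using lattice_nested[OF D RD assms(2)] False by blast
  then have "indicator R x *\<^sub>R u x = u x" for x using assms(3)[of x] by (auto simp: indicator_def)
  then show ?thesis using assms(4) unfolding set_lebesgue_integral_def by (simp only:)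
qed

lemma cube_form_cancel_left:
  assumes "Q \<in> D" "P \<in> D" "\<And>x. x \<notin> P \<Longrightarrow> u x = 0" "integral\<^sup>L lebesgue u = 0"
    and "sidelen P < sidelen Q / 2^m1" "integrable lebesgue u" "integrable lebesgue v"
  shows "cube_form s Q u v = 0"
proof -
  obtain c where "cube_form s Q u v = (\<Sum>R1\<in>descs (Suc m1) Q. \<Sum>R2\<in>descs (Suc m2) Q.
        c R1 R2 * ((LINT x:R1|lebesgue. u x) * (LINT x:R2|lebesgue. v x)))"
    by (rule cube_form_descs[OF D s assms(1)]) (use assms(6,7) in blast)
  also have "\<dots> = 0"
    using set_integral_small_cube_zero[OF assms(1-5)] by (intro sum.neutral ballI) simp
  finally show ?thesis .
qed

lemma cube_form_cancel_right:
  assumes "Q \<in> D" "P \<in> D" "\<And>x. x \<notin> P \<Longrightarrow> v x = 0" "integral\<^sup>L lebesgue v = 0"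
    and "sidelen P < sidelen Q / 2^m2" "integrable lebesgue u" "integrable lebesgue v"
  shows "cube_form s Q u v = 0"
proof -
  obtain c where "cube_form s Q u v = (\<Sum>R1\<in>descs (Suc m1) Q. \<Sum>R2\<in>descs (Suc m2) Q.
        c R1 R2 * ((LINT x:R1|lebesgue. u x) * (LINT x:R2|lebesgue. v x)))"
    by (rule cube_form_descs[OF D s assms(1)]) (use assms(6,7) in blast)
  also have "\<dots> = 0"
    using set_integral_small_cube_zero[OF assms(1-5)] by (intro sum.neutral ballI) simp
  finally show ?thesis .
qed

end

section \<open>The scalar Calderon--Zygmund estimate\<close>

definition cube_avg :: "(real^'d \<Rightarrow> real) \<Rightarrow> (real^'d) set \<Rightarrow> real" where
  "cube_avg u P = (LINT x:P|lebesgue. u x) / measure lebesgue P"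

text \<open>A conditional expectation on a finite partition. The usual good part also keeps
  \<open>u\<close> off the cubes; here the cubes will cover a set outside which \<open>u\<close>
  vanishes.\<close>

definition good_part :: "(real^'d) set set \<Rightarrow> (real^'d \<Rightarrow> real) \<Rightarrow> real^'d \<Rightarrow> real" where
  "good_part PP u x = (\<Sum>P\<in>PP. indicator P x * cube_avg u P)"

definition bad_part :: "(real^'d \<Rightarrow> real) \<Rightarrow> (real^'d) set \<Rightarrow> real^'d \<Rightarrow> real" where
  "bad_part u P x = indicator P x * (u x - cube_avg u P)"

lemma abs_cube_avg_le:
  assumes "is_cube P" "(LINT x:P|lebesgue. \<bar>u x\<bar>) \<le> \<alpha> * measure lebesgue P"
  shows "\<bar>cube_avg u P\<bar> \<le> \<alpha>"
proof -
  have "\<bar>LINT x:P|lebesgue. u x\<bar> \<le> \<alpha> * measure lebesgue P"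
    using set_integral_abs_le assms(2) by (rule order_trans)
  then show ?thesis
    using is_cube_measure_pos[OF assms(1)] by (simp add: cube_avg_def abs_div field_simps)
qed

lemma bad_part_integrable:
  assumes "is_cube P" "integrable lebesgue u"
  shows "integrable lebesgue (bad_part u P)"
proof -
  have "integrable lebesgue (\<lambda>x. indicator P x * u x - cube_avg u P * indicator P x)"
    using is_cube_lmeasurable[OF assms(1)] assms(2)
    by (intro Bochner_Integration.integrable_diff integrable_indicator_times integrable_mult_right
        integrable_real_indicator) (auto simp: fmeasurable_def)
  then show ?thesis by (simp add: bad_part_def[abs_def] algebra_simps)
qed

lemma bad_part_integral:
  assumes "is_cube P" "integrable lebesgue u"
  shows "integral\<^sup>L lebesgue (bad_part u P) = 0"
proof -
  have P: "P \<in> lmeasurable" "measure lebesgue P > 0"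
    using is_cube_lmeasurable is_cube_measure_pos assms(1) by blast+
  have "integral\<^sup>L lebesgue (bad_part u P)
      = (LINT x|lebesgue. indicator P x * u x - cube_avg u P * indicator P x)"
    by (simp add: bad_part_def[abs_def] algebra_simps)
  also have "\<dots> = (LINT x:P|lebesgue. u x) - cube_avg u P * measure lebesgue P"
    using P(1) assms(2)
    by (subst Bochner_Integration.integral_diff)
      (auto intro!: integrable_indicator_times integrable_mult_right integrable_real_indicator
        simp: fmeasurable_def set_lebesgue_integral_def)
  also have "\<dots> = 0" using P(2) by (simp add: cube_avg_def)
  finally show ?thesis .
qed

lemma bad_part_abs_integral:
  assumes "is_cube P" "integrable lebesgue u" "Q \<in> sets lebesgue"
  shows "(LINT x:Q|lebesgue. \<bar>bad_part u P x\<bar>) \<le> 2 * (LINT x:P|lebesgue. \<bar>u x\<bar>)"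
proof -
  have P: "P \<in> lmeasurable" "measure lebesgue P > 0"
    using is_cube_lmeasurable is_cube_measure_pos assms(1) by blast+
  have i: "integrable lebesgue (\<lambda>x. indicator P x * \<bar>u x\<bar>)" "integrable lebesgue (\<lambda>x. \<bar>cube_avg u P\<bar> * indicator P x)"
    using P(1) assms(2)
    by (auto intro!: integrable_indicator_times integrable_mult_right integrable_real_indicator
        simp: fmeasurable_def)
  have "(LINT x:Q|lebesgue. \<bar>bad_part u P x\<bar>)
      \<le> (LINT x|lebesgue. indicator P x * \<bar>u x\<bar> + \<bar>cube_avg u P\<bar> * indicator P x)"
    unfolding set_lebesgue_integral_def
  proof (rule integral_mono)
    show "integrable lebesgue (\<lambda>x. indicator Q x *\<^sub>R \<bar>bad_part u P x\<bar>)"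
      using assms by (intro integrable_mult_indicator integrable_abs bad_part_integrable)
    show "indicator Q x *\<^sub>R \<bar>bad_part u P x\<bar> \<le> indicator P x * \<bar>u x\<bar> + \<bar>cube_avg u P\<bar> * indicator P x" for x
      by (auto simp: bad_part_def indicator_def)
  qed (intro Bochner_Integration.integrable_add i)
  also have "\<dots> = (LINT x:P|lebesgue. \<bar>u x\<bar>) + \<bar>cube_avg u P\<bar> * measure lebesgue P"
    using P(1) by (subst Bochner_Integration.integral_add[OF i]) (auto simp: set_lebesgue_integral_def)
  also have "\<bar>cube_avg u P\<bar> * measure lebesgue P = \<bar>LINT x:P|lebesgue. u x\<bar>"
    using P(2) by (simp add: cube_avg_def abs_div)
  also have "\<dots> \<le> (LINT x:P|lebesgue. \<bar>u x\<bar>)" by (rule set_integral_abs_le)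
  finally show ?thesis by simp
qed

text \<open>\<open>\<Phi>\<close> stands for the form with one argument frozen, so one count serves
  both arguments. As \<open>Q\<close> is never strictly inside \<open>P\<close>, the cubes are
  disjoint or \<open>P\<close> lies in \<open>Q\<close>. In the second case cancellation leaves only
  the \<open>Q\<close> at most \<open>m\<close> generations up, and each of them costs
  \<open>B\<close> times the mass of the bad part, which is at most twice the mass of
  \<open>u\<close> on \<open>P\<close>.\<close>

lemma bad_part_sum_le:
  fixes D :: "(real^'d) set set" and \<Phi> :: "(real^'d) set \<Rightarrow> (real^'d \<Rightarrow> real) \<Rightarrow> real"
  assumes D: "dyadic_lattice D" and PP: "finite PP" "PP \<subseteq> D" and F: "finite F" "F \<subseteq> D"
    and u: "integrable lebesgue u" and B: "0 \<le> B"
    and bound: "\<And>Q w. Q \<in> F \<Longrightarrow> integrable lebesgue w \<Longrightarrow> \<bar>\<Phi> Q w\<bar> \<le> B * (LINT x:Q|lebesgue. \<bar>w x\<bar>)"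
    and cancel: "\<And>Q P w. Q \<in> F \<Longrightarrow> P \<in> PP \<Longrightarrow> integrable lebesgue w \<Longrightarrow> (\<And>x. x \<notin> P \<Longrightarrow> w x = 0) \<Longrightarrow>
        integral\<^sup>L lebesgue w = 0 \<Longrightarrow> sidelen P < sidelen Q / 2^m \<Longrightarrow> \<Phi> Q w = 0"
    and ns: "\<And>Q P. Q \<in> F \<Longrightarrow> P \<in> PP \<Longrightarrow> \<not> Q \<subset> P"
  shows "\<bar>\<Sum>Q\<in>F. \<Sum>P\<in>PP. \<Phi> Q (bad_part u P)\<bar>
    \<le> 2 * real (m + 1) * B * (\<Sum>P\<in>PP. LINT x:P|lebesgue. \<bar>u x\<bar>)"
proof -
  define near where "near Q P \<longleftrightarrow> P \<subseteq> Q \<and> \<not> sidelen P < sidelen Q / 2^m" for Q P :: "(real^'d) set"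
  let ?I = "\<lambda>P. LINT x:P|lebesgue. \<bar>u x\<bar>"
  have term_le: "\<bar>\<Phi> Q (bad_part u P)\<bar> \<le> (if near Q P then B * (2 * ?I P) else 0)"
    if Q: "Q \<in> F" and P: "P \<in> PP" for Q P
  proof -
    have QP: "Q \<in> D" "P \<in> D" "is_cube Q" "is_cube P"
      using Q P F PP lattice_is_cube[OF D] by blast+
    have int: "integrable lebesgue (bad_part u P)" using bad_part_integrable[OF QP(4) u] .
    have Qm: "Q \<in> sets lebesgue" using is_cube_lmeasurable[OF QP(3)] by auto
    consider "near Q P" | "P \<subseteq> Q" "sidelen P < sidelen Q / 2^m" | "\<not> P \<subseteq> Q"
      by (auto simp: near_def)
    then show ?thesis
    proof cases
      case 1
      have "\<bar>\<Phi> Q (bad_part u P)\<bar> \<le> B * (LINT x:Q|lebesgue. \<bar>bad_part u P x\<bar>)"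
        by (rule bound[OF Q int])
      also have "\<dots> \<le> B * (2 * ?I P)"
        by (intro mult_left_mono bad_part_abs_integral QP u Qm B)
      finally show ?thesis using 1 by simp
    next
      case 2
      then have "\<Phi> Q (bad_part u P) = 0"
        by (intro cancel[OF Q P int]) (auto simp: bad_part_def bad_part_integral[OF QP(4) u])
      then show ?thesis using 2 by (simp add: near_def)
    next
      case 3
      then have "Q \<inter> P = {}"
        using lattice_trichotomy[OF D QP(1,2)] ns[OF Q P] by blast
      then have "indicator Q x *\<^sub>R \<bar>bad_part u P x\<bar> = 0" for x
        by (auto simp: bad_part_def indicator_def)
      then have "(LINT x:Q|lebesgue. \<bar>bad_part u P x\<bar>) = 0"
        unfolding set_lebesgue_integral_def by (simp only: Bochner_Integration.integral_zero)
      then have "\<Phi> Q (bad_part u P) = 0" using bound[OF Q int] by simp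
      then show ?thesis using 3 by (simp add: near_def)
    qed
  qed
  have "\<bar>\<Sum>Q\<in>F. \<Sum>P\<in>PP. \<Phi> Q (bad_part u P)\<bar> \<le> (\<Sum>Q\<in>F. \<Sum>P\<in>PP. if near Q P then B * (2 * ?I P) else 0)"
    by (intro order_trans[OF sum_abs] sum_mono term_le)
  also have "\<dots> = (\<Sum>P\<in>PP. \<Sum>Q\<in>F. if near Q P then B * (2 * ?I P) else 0)"
    by (rule sum.swap)
  also have "\<dots> = (\<Sum>P\<in>PP. real (card {Q\<in>F. near Q P}) * (B * (2 * ?I P)))"
    by (intro sum.cong refl) (simp add: sum.If_cases[OF F(1)] Int_def)
  also have "\<dots> \<le> (\<Sum>P\<in>PP. real (m + 1) * (B * (2 * ?I P)))"
  proof (intro sum_mono mult_right_mono)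
    fix P assume "P \<in> PP"
    then have "P \<in> D" using PP by blast
    then have "card {Q\<in>F. near Q P} \<le> m + 1"
      unfolding near_def using card_ancestors_le[OF D _ F] by blast
    then show "real (card {Q\<in>F. near Q P}) \<le> real (m + 1)" by linarith
    show "0 \<le> B * (2 * ?I P)" using B set_integral_abs_nonneg[of lebesgue P u] by simp
  qed
  also have "\<dots> = 2 * real (m + 1) * B * (\<Sum>P\<in>PP. ?I P)"
    by (simp only: sum_distrib_left mult_ac)
  finally show ?thesis .
qed

lemma good_part_abs_le:
  assumes "finite PP" "0 \<le> \<alpha>"
    and dis: "\<And>P P' x. P \<in> PP \<Longrightarrow> P' \<in> PP \<Longrightarrow> x \<in> P \<Longrightarrow> x \<in> P' \<Longrightarrow> P = P'"
    and "\<And>P. P \<in> PP \<Longrightarrow> \<bar>cube_avg u P\<bar> \<le> \<alpha>"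
  shows "\<bar>good_part PP u x\<bar> \<le> \<alpha>"
proof (cases "\<exists>P\<in>PP. x \<in> P")
  case True
  then obtain P where P: "P \<in> PP" "x \<in> P" by blast
  have "good_part PP u x = cube_avg u P"
    unfolding good_part_def
    by (rule sum_indicator_partition[OF assms(1) P]) (use dis P in blast)
  then show ?thesis using assms(4) P by simp
next
  case False
  then have "good_part PP u x = 0" unfolding good_part_def by (intro sum.neutral) auto
  then show ?thesis using assms by simp
qed

lemma good_part_eq_0: "x \<notin> \<Union>PP \<Longrightarrow> good_part PP u x = 0"
  unfolding good_part_def by (intro sum.neutral) auto

lemma good_part_integrable:
  assumes "\<And>P. P \<in> PP \<Longrightarrow> is_cube P"
  shows "integrable lebesgue (good_part PP u)"
  unfolding good_part_def[abs_def]
  using is_cube_lmeasurable[OF assms]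
  by (intro Bochner_Integration.integrable_sum integrable_mult_left)
    (auto simp: lmeasurable_iff_integrable)

lemma good_plus_bad:
  assumes "finite PP" "x \<notin> \<Union>PP \<Longrightarrow> u x = 0"
    and dis: "\<And>P P' x. P \<in> PP \<Longrightarrow> P' \<in> PP \<Longrightarrow> x \<in> P \<Longrightarrow> x \<in> P' \<Longrightarrow> P = P'"
  shows "u x = good_part PP u x + (\<Sum>P\<in>PP. bad_part u P x)"
proof -
  have "good_part PP u x + (\<Sum>P\<in>PP. bad_part u P x) = (\<Sum>P\<in>PP. indicator P x * u x)"
    by (simp add: good_part_def bad_part_def sum.distrib[symmetric] algebra_simps)
  also have "\<dots> = u x"
  proof (cases "\<exists>P\<in>PP. x \<in> P")
    case True
    then obtain P where P: "P \<in> PP" "x \<in> P" by blast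
    show ?thesis by (rule sum_indicator_partition[OF assms(1) P]) (use dis P in blast)
  next
    case False
    then show ?thesis using assms(2) by (intro trans[OF sum.neutral]) auto
  qed
  finally show ?thesis by simp
qed

text \<open>The good part is bounded by \<open>\<alpha>\<close> and carried by the cubes, hence the
  square root of their total measure; two such factors give that measure in the L2 bound of the
  shift.\<close>

lemma good_part_L2:
  assumes "finite PP" "\<And>P. P \<in> PP \<Longrightarrow> is_cube P" "0 \<le> \<alpha>"
    and dis: "\<And>P P' x. P \<in> PP \<Longrightarrow> P' \<in> PP \<Longrightarrow> x \<in> P \<Longrightarrow> x \<in> P' \<Longrightarrow> P = P'"
    and "\<And>P. P \<in> PP \<Longrightarrow> \<bar>cube_avg u P\<bar> \<le> \<alpha>"
  shows "L2_fun (good_part PP u)" "L2_norm (good_part PP u) \<le> \<alpha> * sqrt (\<Sum>P\<in>PP. measure lebesgue P)"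
proof -
  let ?G = "good_part PP u"
  have PPm: "P \<in> lmeasurable" if "P \<in> PP" for P using is_cube_lmeasurable assms(2) that by blast
  have meas: "?G \<in> borel_measurable lebesgue"
    using good_part_integrable[of PP u] assms(2) by blast
  have iu: "integrable lebesgue (\<lambda>x. \<Sum>P\<in>PP. \<alpha>^2 * indicator P x)"
    using PPm by (intro Bochner_Integration.integrable_sum integrable_mult_right)
      (auto simp: lmeasurable_iff_integrable)
  have le: "(?G x)^2 \<le> (\<Sum>P\<in>PP. \<alpha>^2 * indicator P x)" for x
  proof (cases "\<exists>P\<in>PP. x \<in> P")
    case True
    then obtain P where P: "P \<in> PP" "x \<in> P" by blast
    have "(?G x)^2 = \<bar>?G x\<bar>^2" by simp
    also have "\<dots> \<le> \<alpha>^2"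
      using good_part_abs_le[OF assms(1,3) dis assms(5)] by (intro power_mono) auto
    also have "\<dots> = \<alpha>^2 * indicator P x" using P by simp
    also have "\<dots> \<le> (\<Sum>P\<in>PP. \<alpha>^2 * indicator P x)"
      by (rule member_le_sum[OF P(1)]) (use assms(1) in auto)
    finally show ?thesis .
  next
    case False
    then have "?G x = 0" by (intro good_part_eq_0) auto
    then show ?thesis by (simp add: sum_nonneg)
  qed
  have int: "integrable lebesgue (\<lambda>x. (?G x)^2)"
    using meas le by (intro Bochner_Integration.integrable_bound[OF iu]) (auto intro!: AE_I2 order_trans[OF le abs_ge_self])
  then show "L2_fun ?G" using meas by (simp add: L2_fun_def)
  have "(LINT x|lebesgue. (?G x)^2) \<le> (LINT x|lebesgue. (\<Sum>P\<in>PP. \<alpha>^2 * indicator P x))"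
    by (rule integral_mono[OF int iu le])
  also have "\<dots> = (\<Sum>P\<in>PP. \<alpha>^2 * measure lebesgue P)"
    using PPm by (subst Bochner_Integration.integral_sum)
      (auto simp: lmeasurable_iff_integrable)
  also have "\<dots> = \<alpha>^2 * (\<Sum>P\<in>PP. measure lebesgue P)" by (simp add: sum_distrib_left)
  finally show "L2_norm ?G \<le> \<alpha> * sqrt (\<Sum>P\<in>PP. measure lebesgue P)"
    unfolding L2_norm_def using assms(3)
    by (metis real_sqrt_le_mono real_sqrt_mult real_sqrt_unique)
qed

text \<open>\<open>h\<close> is split only against the good part of \<open>g\<close>, while the bad
  part of \<open>g\<close> is paired with all of \<open>h\<close>. This avoids a separate term with
  two bad parts. The price is \<open>hQ\<close>, a bound for the means of \<open>h\<close> over the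
  cubes of the shift themselves; the other mixed term uses the pointwise bound of the good
  part.\<close>

lemma shift_form_scalar_bound:
  fixes D :: "(real^'d) set set"
  assumes D: "dyadic_lattice D" and s: "dyadic_shift D m1 m2 s"
    and PP: "finite PP" "PP \<subseteq> D" and QQ: "QQ \<subseteq> D"
    and dis: "\<And>P P' x. P \<in> PP \<Longrightarrow> P' \<in> PP \<Longrightarrow> x \<in> P \<Longrightarrow> x \<in> P' \<Longrightarrow> P = P'"
    and g: "integrable lebesgue g" "\<And>x. x \<notin> \<Union>PP \<Longrightarrow> g x = 0"
    and h: "integrable lebesgue h" "\<And>x. x \<notin> \<Union>PP \<Longrightarrow> h x = 0"
    and ab: "0 \<le> \<alpha>" "0 \<le> \<beta>"
    and gP: "\<And>P. P \<in> PP \<Longrightarrow> (LINT x:P|lebesgue. \<bar>g x\<bar>) \<le> \<alpha> * measure lebesgue P"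
    and hP: "\<And>P. P \<in> PP \<Longrightarrow> (LINT x:P|lebesgue. \<bar>h x\<bar>) \<le> \<beta> * measure lebesgue P"
    and hQ: "\<And>Q. Q \<in> nz_cubes s QQ \<Longrightarrow> (LINT x:Q|lebesgue. \<bar>h x\<bar>) \<le> \<beta> * measure lebesgue Q"
    and ns: "\<And>Q P. Q \<in> nz_cubes s QQ \<Longrightarrow> P \<in> PP \<Longrightarrow> \<not> Q \<subset> P"
  shows "\<bar>shift_form QQ s g h\<bar> \<le> (5 + 2 * real m1 + 2 * real m2) * (\<alpha> * \<beta>) * (\<Sum>P\<in>PP. measure lebesgue P)"
proof -
  define F where "F = nz_cubes s QQ"
  define M where "M = (\<Sum>P\<in>PP. measure lebesgue P)"
  define G1 where "G1 = good_part PP g"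
  define G2 where "G2 = good_part PP h"
  have F: "finite F" "F \<subseteq> D"
  proof -
    have "F \<subseteq> nz_cubes s D" using QQ by (auto simp: F_def nz_cubes_def)
    then show "finite F" using dyadic_shift_finite[OF s] by (rule finite_subset)
    show "F \<subseteq> D" using QQ by (auto simp: F_def nz_cubes_def)
  qed
  have cubes: "is_cube P" if "P \<in> PP" for P using lattice_is_cube[OF D] PP that by blast
  have M0: "0 \<le> M" unfolding M_def by (intro sum_nonneg) simp
  have avg1: "\<bar>cube_avg g P\<bar> \<le> \<alpha>" if "P \<in> PP" for P by (rule abs_cube_avg_le[OF cubes[OF that] gP[OF that]])
  have avg2: "\<bar>cube_avg h P\<bar> \<le> \<beta>" if "P \<in> PP" for P by (rule abs_cube_avg_le[OF cubes[OF that] hP[OF that]])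
  have iG: "integrable lebesgue G1" "integrable lebesgue G2"
    unfolding G1_def G2_def using good_part_integrable cubes by blast+
  have ib: "integrable lebesgue (bad_part g P)" "integrable lebesgue (bad_part h P)" if "P \<in> PP" for P
    using bad_part_integrable[OF cubes[OF that]] g h by blast+
  have split: "cube_form s Q g h = cube_form s Q G1 G2 + (\<Sum>P\<in>PP. cube_form s Q G1 (bad_part h P))
      + (\<Sum>P\<in>PP. cube_form s Q (bad_part g P) h)" if "Q \<in> F" for Q
  proof -
    have Q: "Q \<in> D" using that F by blast
    have g_eq: "g = (\<lambda>x. G1 x + (\<Sum>P\<in>PP. bad_part g P x))"
      unfolding G1_def by (rule ext, rule good_plus_bad[OF PP(1)], erule g(2), rule dis)
    have h_eq: "h = (\<lambda>x. G2 x + (\<Sum>P\<in>PP. bad_part h P x))"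
      unfolding G2_def by (rule ext, rule good_plus_bad[OF PP(1)], erule h(2), rule dis)
    have "cube_form s Q g h = cube_form s Q G1 h + cube_form s Q (\<lambda>x. \<Sum>P\<in>PP. bad_part g P x) h"
      by (subst g_eq, rule cube_form_add_left[OF D s Q iG(1) _ h(1)]) (intro Bochner_Integration.integrable_sum ib)
    also have "cube_form s Q (\<lambda>x. \<Sum>P\<in>PP. bad_part g P x) h = (\<Sum>P\<in>PP. cube_form s Q (bad_part g P) h)"
      by (rule cube_form_sum_left[OF D s Q PP(1) ib(1) h(1)])
    also have "cube_form s Q G1 h = cube_form s Q G1 G2 + cube_form s Q G1 (\<lambda>x. \<Sum>P\<in>PP. bad_part h P x)"
      by (subst h_eq, rule cube_form_add_right[OF D s Q iG]) (intro Bochner_Integration.integrable_sum ib)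
    also have "cube_form s Q G1 (\<lambda>x. \<Sum>P\<in>PP. bad_part h P x) = (\<Sum>P\<in>PP. cube_form s Q G1 (bad_part h P))"
      by (rule cube_form_sum_right[OF D s Q PP(1) ib(2) iG(1)])
    finally show ?thesis .
  qed
  have total: "shift_form QQ s g h = shift_form QQ s G1 G2
      + (\<Sum>Q\<in>F. \<Sum>P\<in>PP. cube_form s Q G1 (bad_part h P))
      + (\<Sum>Q\<in>F. \<Sum>P\<in>PP. cube_form s Q (bad_part g P) h)"
    unfolding shift_form_eq F_def[symmetric] sum.distrib[symmetric] by (rule sum.cong[OF refl split])
  have part1: "\<bar>shift_form QQ s G1 G2\<bar> \<le> \<alpha> * \<beta> * M"
  proof -
    have L1: "L2_fun G1" "L2_norm G1 \<le> \<alpha> * sqrt M"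
      unfolding G1_def M_def by (rule good_part_L2[OF PP(1) cubes ab(1) dis avg1]; assumption)+
    have L2: "L2_fun G2" "L2_norm G2 \<le> \<beta> * sqrt M"
      unfolding G2_def M_def by (rule good_part_L2[OF PP(1) cubes ab(2) dis avg2]; assumption)+
    have "\<bar>shift_form QQ s G1 G2\<bar> \<le> L2_norm G1 * L2_norm G2"
      by (rule dyadic_shift_L2[OF s QQ L1(1) L2(1)])
    also have "\<dots> \<le> (\<alpha> * sqrt M) * (\<beta> * sqrt M)"
      using L1(2) L2(2) ab M0 by (intro mult_mono) (auto simp: L2_norm_def)
    also have "\<dots> = \<alpha> * \<beta> * M" using M0 by simp
    finally show ?thesis .
  qed
  have G1_abs: "\<bar>G1 x\<bar> \<le> \<alpha>" for x
    unfolding G1_def by (rule good_part_abs_le[OF PP(1) ab(1) dis avg1])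
  have G1_le: "(LINT x:Q|lebesgue. \<bar>G1 x\<bar>) \<le> \<alpha> * measure lebesgue Q" if "Q \<in> F" for Q
  proof -
    have Q: "Q \<in> lmeasurable" using is_cube_lmeasurable lattice_is_cube[OF D] F that by blast
    have "(LINT x:Q|lebesgue. \<bar>G1 x\<bar>) \<le> (LINT x|lebesgue. \<alpha> * indicator Q x)"
      unfolding set_lebesgue_integral_def
    proof (rule integral_mono)
      show "integrable lebesgue (\<lambda>x. indicator Q x *\<^sub>R \<bar>G1 x\<bar>)"
        using Q iG by (intro integrable_mult_indicator) auto
      show "integrable lebesgue (\<lambda>x. \<alpha> * indicator Q x)"
        using Q by (intro integrable_mult_right) (simp add: lmeasurable_iff_integrable)
      show "indicator Q x *\<^sub>R \<bar>G1 x\<bar> \<le> \<alpha> * indicator Q x" for x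
        using G1_abs[of x] by (auto simp: indicator_def)
    qed
    also have "\<dots> = \<alpha> * measure lebesgue Q" using Q by simp
    finally show ?thesis .
  qed
  \<comment> \<open>Bounded means on \<open>Q\<close> cancel the factor 1/|Q| of the size estimate
    and leave the L1 norm that \<open>bad_part_sum_le\<close> asks for.\<close>
  have frac: "a * b / measure lebesgue Q \<le> c * a" if "Q \<in> F" "0 \<le> a" "b \<le> c * measure lebesgue Q" for a b c Q
  proof -
    have "0 < measure lebesgue Q" using is_cube_measure_pos lattice_is_cube[OF D] F that by blast
    moreover have "a * b \<le> a * (c * measure lebesgue Q)" using that by (intro mult_left_mono)
    ultimately show ?thesis by (simp add: field_simps)
  qed
  have part2: "\<bar>\<Sum>Q\<in>F. \<Sum>P\<in>PP. cube_form s Q G1 (bad_part h P)\<bar>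
      \<le> 2 * real (m2 + 1) * \<alpha> * (\<Sum>P\<in>PP. LINT x:P|lebesgue. \<bar>h x\<bar>)"
  proof (rule bad_part_sum_le[OF D PP F h(1) ab(1)])
    fix Q and w :: "real^'d \<Rightarrow> real" assume *: "Q \<in> F" "integrable lebesgue w"
    then have Q: "Q \<in> D" using F by blast
    show "\<bar>cube_form s Q G1 w\<bar> \<le> \<alpha> * (LINT x:Q|lebesgue. \<bar>w x\<bar>)"
      using cube_form_abs_le[OF D s Q iG(1) *(2)]
        frac[OF *(1) set_integral_abs_nonneg G1_le[OF *(1)], of lebesgue Q w]
      by (simp add: mult.commute)
  next
    fix Q P and w :: "real^'d \<Rightarrow> real" assume "Q \<in> F" "P \<in> PP" "integrable lebesgue w" "\<And>x. x \<notin> P \<Longrightarrow> w x = 0"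
      "integral\<^sup>L lebesgue w = 0" "sidelen P < sidelen Q / 2^m2"
    then show "cube_form s Q G1 w = 0"
      using F PP iG by (intro cube_form_cancel_right[OF D s, where P=P]) auto
  qed (use ns F_def in blast)
  have part3: "\<bar>\<Sum>Q\<in>F. \<Sum>P\<in>PP. cube_form s Q (bad_part g P) h\<bar>
      \<le> 2 * real (m1 + 1) * \<beta> * (\<Sum>P\<in>PP. LINT x:P|lebesgue. \<bar>g x\<bar>)"
  proof (rule bad_part_sum_le[OF D PP F g(1) ab(2)])
    fix Q and w :: "real^'d \<Rightarrow> real" assume *: "Q \<in> F" "integrable lebesgue w"
    then have Q: "Q \<in> D" using F by blast
    show "\<bar>cube_form s Q w h\<bar> \<le> \<beta> * (LINT x:Q|lebesgue. \<bar>w x\<bar>)"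
      using cube_form_abs_le[OF D s Q *(2) h(1)]
        frac[OF *(1) set_integral_abs_nonneg hQ[OF *(1)[unfolded F_def]], of lebesgue Q w]
      by (simp add: mult.commute)
  next
    fix Q P and w :: "real^'d \<Rightarrow> real" assume "Q \<in> F" "P \<in> PP" "integrable lebesgue w" "\<And>x. x \<notin> P \<Longrightarrow> w x = 0"
      "integral\<^sup>L lebesgue w = 0" "sidelen P < sidelen Q / 2^m1"
    then show "cube_form s Q w h = 0"
      using F PP h by (intro cube_form_cancel_left[OF D s, where P=P]) auto
  qed (use ns F_def in blast)
  have g_tot: "(\<Sum>P\<in>PP. LINT x:P|lebesgue. \<bar>g x\<bar>) \<le> \<alpha> * M"
    unfolding M_def sum_distrib_left by (intro sum_mono gP)
  have h_tot: "(\<Sum>P\<in>PP. LINT x:P|lebesgue. \<bar>h x\<bar>) \<le> \<beta> * M"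
    unfolding M_def sum_distrib_left by (intro sum_mono hP)
  have "2 * real (m2 + 1) * \<alpha> * (\<Sum>P\<in>PP. LINT x:P|lebesgue. \<bar>h x\<bar>) \<le> 2 * real (m2 + 1) * \<alpha> * (\<beta> * M)"
    using ab by (intro mult_left_mono h_tot) simp
  moreover have "2 * real (m1 + 1) * \<beta> * (\<Sum>P\<in>PP. LINT x:P|lebesgue. \<bar>g x\<bar>) \<le> 2 * real (m1 + 1) * \<beta> * (\<alpha> * M)"
    using ab by (intro mult_left_mono g_tot) simp
  ultimately have "\<bar>shift_form QQ s g h\<bar> \<le> \<alpha> * \<beta> * M + 2 * real (m2 + 1) * \<alpha> * (\<beta> * M)
      + 2 * real (m1 + 1) * \<beta> * (\<alpha> * M)"
    unfolding total using part1 part2 part3 by linarith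
  \<comment> \<open>The two good parts contribute 1, the mixed terms \<open>2 * (m2 + 1)\<close> and
    \<open>2 * (m1 + 1)\<close>.\<close>
  also have "\<dots> = (5 + 2 * real m1 + 2 * real m2) * (\<alpha> * \<beta>) * M"
    by (simp add: algebra_simps)
  finally show ?thesis unfolding M_def .
qed

section \<open>Convex bodies of averages\<close>

text \<open>The supremum of the norms may not be attained, but some element has more than half of
  it.\<close>

lemma bounded_near_max_norm:
  fixes K :: "'a::real_normed_vector set"
  assumes "bounded K" "k \<in> K" "k \<noteq> 0"
  obtains e where "e \<in> K" "e \<noteq> 0" "\<And>x. x \<in> K \<Longrightarrow> norm x \<le> 2 * norm e"
proof -
  have bdd: "bdd_above (norm ` K)"
    using assms(1) by (auto simp: bounded_iff bdd_above_def)
  define S where "S = Sup (norm ` K)"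
  have le: "norm x \<le> S" if "x \<in> K" for x
    unfolding S_def using bdd that by (intro cSup_upper) auto
  have "0 < S" using le[OF assms(2)] assms(3) by (meson less_le_trans zero_less_norm_iff)
  then have "S / 2 < Sup (norm ` K)" by (simp add: S_def)
  then obtain y where "y \<in> norm ` K" "S / 2 < y"
    using less_cSupD[of "norm ` K"] assms(2) by blast
  then obtain e where e: "e \<in> K" "S / 2 < norm e" by blast
  show ?thesis
  proof (rule that[OF e(1)])
    show "e \<noteq> 0" using e \<open>0 < S\<close> by auto
    show "norm x \<le> 2 * norm e" if "x \<in> K" for x using le[OF that] e(2) by simp
  qed
qed

text \<open>A greedy substitute for an Auerbach basis: splitting off a vector of almost maximal norm
  and recursing on the orthogonal projection costs only a dimensional constant, and needs neither
  closedness nor full dimension.\<close>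

lemma approx_Auerbach:
  "\<exists>C\<ge>0. \<forall>K::'a::euclidean_space set. 0 \<in> K \<and> bounded K \<and> dim K \<le> m \<longrightarrow>
     (\<exists>b w. (\<forall>i<m. b i \<in> K) \<and> (\<forall>k\<in>K. k = (\<Sum>i<m. (w i \<bullet> k) *\<^sub>R b i)) \<and> (\<forall>i<m. \<forall>k\<in>K. \<bar>w i \<bullet> k\<bar> \<le> C))"
  (is "\<exists>C\<ge>0. ?P m C")
proof (induction m)
  case 0
  show ?case by (intro exI[of _ 0]) (auto simp: dim_eq_0)
next
  case (Suc m)
  then obtain C where C: "0 \<le> C" and IH: "?P m C"
    by (elim exE conjE) (rule that)
  \<comment> \<open>The last functional is bounded by 2 for its component along \<open>e\<close>,
    plus \<open>2 * C\<close> for each of \<open>m\<close> corrections; the first \<open>m\<close>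
    functionals keep the bound \<open>C\<close>.\<close>
  define C' where "C' = C + (2 + 2 * real m * C)"
  have C': "0 \<le> C'" "C \<le> C'" "2 + 2 * real m * C \<le> C'" using C by (auto simp: C'_def)
  show ?case
  proof (intro exI[of _ C'] conjI allI impI C'(1))
    fix K :: "'a set" assume K: "0 \<in> K \<and> bounded K \<and> dim K \<le> Suc m"
    show "\<exists>b w. (\<forall>i<Suc m. b i \<in> K) \<and> (\<forall>k\<in>K. k = (\<Sum>i<Suc m. (w i \<bullet> k) *\<^sub>R b i))
       \<and> (\<forall>i<Suc m. \<forall>k\<in>K. \<bar>w i \<bullet> k\<bar> \<le> C')"
    proof (cases "\<exists>k\<in>K. k \<noteq> 0")
      case False
      then show ?thesis using K C' by (intro exI[of _ "\<lambda>_. 0"]) auto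
    next
      case True
      then obtain e where e: "e \<in> K" "e \<noteq> 0" and emax: "\<And>x. x \<in> K \<Longrightarrow> norm x \<le> 2 * norm e"
        using bounded_near_max_norm K by metis
      define N where "N = e \<bullet> e"
      have N: "0 < N" "N = norm e * norm e" using e(2) by (auto simp: N_def dot_square_norm power2_eq_square)
      \<comment> \<open>Orthogonal projection onto the complement of \<open>e\<close>.\<close>
      define T where "T v = v - ((e \<bullet> v) / N) *\<^sub>R e" for v
      have Te: "e \<bullet> T v = 0" for v using N(1) by (simp add: T_def inner_diff_right N_def[symmetric])
      have lin: "bounded_linear T"
        unfolding T_def[abs_def] divide_inverse
        by (intro bounded_linear_intros)
      have Tsym: "T a \<bullet> v = a \<bullet> T v" for a v
        by (simp add: T_def inner_diff_left inner_diff_right inner_commute)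
      \<comment> \<open>\<open>e\<close> lies in the span of \<open>K\<close> and is orthogonal to
        the projected set, so the projection lowers the dimension.\<close>
      have dimT: "dim (T ` K) \<le> m"
      proof -
        have "T ` K \<subseteq> span K" using e(1) by (auto simp: T_def intro!: span_diff span_scale intro: span_base)
        then have "insert e (T ` K) \<subseteq> span K" using e(1) by (simp add: span_base)
        then have "dim (insert e (T ` K)) \<le> dim K" by (metis dim_span dim_subset)
        moreover have "e \<notin> span (T ` K)"
        proof
          assume "e \<in> span (T ` K)"
          moreover have "span (T ` K) \<subseteq> {x. e \<bullet> x = 0}"
            by (rule span_minimal) (auto simp: Te subspace_hyperplane)
          ultimately show False using e(2) by auto
        qed
        ultimately show ?thesis using K by (simp add: dim_insert)
      qed
      have "0 \<in> T ` K" using K by (auto simp: T_def image_iff intro!: bexI[of _ 0])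
      moreover have "bounded (T ` K)" using K bounded_linear_image lin by blast
      ultimately have "\<exists>b w. (\<forall>i<m. b i \<in> T ` K) \<and> (\<forall>k\<in>T ` K. k = (\<Sum>i<m. (w i \<bullet> k) *\<^sub>R b i))
          \<and> (\<forall>i<m. \<forall>k\<in>T ` K. \<bar>w i \<bullet> k\<bar> \<le> C)"
        using dimT by (intro IH[rule_format] conjI)
      then obtain b' w' where b': "\<forall>i<m. b' i \<in> T ` K"
        and rep: "\<forall>k\<in>T ` K. k = (\<Sum>i<m. (w' i \<bullet> k) *\<^sub>R b' i)"
        and wC: "\<forall>i<m. \<forall>k\<in>T ` K. \<bar>w' i \<bullet> k\<bar> \<le> C"
        by (elim exE conjE) (rule that)
      have "\<forall>i. \<exists>r. i < m \<longrightarrow> r \<in> K \<and> b' i = T r" using b' by blast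
      then obtain r where r: "\<And>i. i < m \<Longrightarrow> r i \<in> K" "\<And>i. i < m \<Longrightarrow> b' i = T (r i)" by metis
      define b where "b i = (if i < m then r i else e)" for i
      \<comment> \<open>The recursion gives vectors in the projected set. Their preimages
        \<open>r i\<close> lie in \<open>K\<close> but differ from them by multiples of
        \<open>e\<close>; the sum subtracted in the last functional makes up for these
        multiples.\<close>
      define w where "w i = (if i < m then T (w' i)
        else (1 / N) *\<^sub>R (e - (\<Sum>j<m. (e \<bullet> r j) *\<^sub>R T (w' j))))" for i
      have w_last: "w m \<bullet> k = (e \<bullet> k) / N - (\<Sum>j<m. (w' j \<bullet> T k) * ((e \<bullet> r j) / N))" for k
        by (simp add: w_def inner_diff_left inner_sum_left Tsym diff_divide_distrib sum_divide_distrib mult_ac)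
      have eb: "\<bar>e \<bullet> k\<bar> / N \<le> 2" if "k \<in> K" for k
      proof -
        have "\<bar>e \<bullet> k\<bar> \<le> norm e * norm k" by (rule Cauchy_Schwarz_ineq2)
        also have "\<dots> \<le> norm e * (2 * norm e)" by (intro mult_left_mono emax that) simp
        finally show ?thesis using N by (simp add: field_simps)
      qed
      show ?thesis
      proof (rule exI[of _ b], rule exI[of _ w], intro conjI allI impI ballI)
        show "b i \<in> K" for i using r e by (simp add: b_def)
      next
        fix k assume k: "k \<in> K"
        have "k = T k + ((e \<bullet> k) / N) *\<^sub>R e" by (simp add: T_def)
        also have "T k = (\<Sum>i<m. (w' i \<bullet> T k) *\<^sub>R b' i)" by (rule rep[rule_format]) (use k in blast)
        also have "\<dots> = (\<Sum>i<m. (w' i \<bullet> T k) *\<^sub>R T (r i))" using r(2) by simp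
        also have "\<dots> = (\<Sum>i<m. (w' i \<bullet> T k) *\<^sub>R r i)
            - (\<Sum>i<m. (w' i \<bullet> T k) * ((e \<bullet> r i) / N)) *\<^sub>R e"
          by (simp add: T_def[of "r _"] scaleR_diff_right sum_subtractf scaleR_left.sum)
        also have "(\<Sum>i<m. (w' i \<bullet> T k) *\<^sub>R r i) - (\<Sum>i<m. (w' i \<bullet> T k) * ((e \<bullet> r i) / N)) *\<^sub>R e
            + ((e \<bullet> k) / N) *\<^sub>R e = (\<Sum>i<m. (w' i \<bullet> T k) *\<^sub>R r i) + (w m \<bullet> k) *\<^sub>R e"
          unfolding w_last by (simp add: scaleR_left_diff_distrib)
        also have "(\<Sum>i<m. (w' i \<bullet> T k) *\<^sub>R r i) = (\<Sum>i<m. (w i \<bullet> k) *\<^sub>R b i)"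
          by (intro sum.cong) (auto simp: w_def b_def Tsym)
        finally show "k = (\<Sum>i<Suc m. (w i \<bullet> k) *\<^sub>R b i)" by (simp add: b_def)
      next
        fix i k assume i: "i < Suc m" and k: "k \<in> K"
        show "\<bar>w i \<bullet> k\<bar> \<le> C'"
        proof (cases "i < m")
          case True
          then have "\<bar>w i \<bullet> k\<bar> \<le> C" using wC[rule_format, of i "T k"] k True by (simp add: w_def Tsym)
          then show ?thesis using C'(2) by linarith
        next
          case False
          then have [simp]: "i = m" using i by simp
          have "\<bar>w m \<bullet> k\<bar> \<le> \<bar>(e \<bullet> k) / N\<bar> + \<bar>\<Sum>j<m. (w' j \<bullet> T k) * ((e \<bullet> r j) / N)\<bar>"
            unfolding w_last by (rule abs_triangle_ineq4)
          also have "\<dots> \<le> 2 + (\<Sum>j<m. C * 2)"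
          proof (intro add_mono order_trans[OF sum_abs] sum_mono)
            show "\<bar>(e \<bullet> k) / N\<bar> \<le> 2" using eb[OF k] N(1) by (simp add: abs_div)
            show "\<bar>(w' j \<bullet> T k) * ((e \<bullet> r j) / N)\<bar> \<le> C * 2" if "j \<in> {..<m}" for j
              unfolding abs_mult using that wC[rule_format, of j "T k"] k eb[OF r(1)[of j]] N(1) C
              by (intro mult_mono) (auto simp: abs_div)
          qed
          also have "\<dots> \<le> C'" using C'(3) by (simp add: mult_ac)
          finally show ?thesis by simp
        qed
      qed
    qed
  qed
qed

section \<open>Averages, pairings and scalar means\<close>

lemma avg_setI:
  assumes "\<phi> \<in> borel_measurable lebesgue" "\<And>x. \<bar>\<phi> x\<bar> \<le> 1" "\<And>x. x \<notin> Q \<Longrightarrow> \<phi> x = 0"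
  shows "(1 / measure lebesgue Q) *\<^sub>R integral\<^sup>L lebesgue (\<lambda>x. \<phi> x *\<^sub>R f x) \<in> avg_set f Q"
  unfolding avg_set_def using assms by blast

lemma zero_in_avg_set: "0 \<in> avg_set f Q"
  using avg_setI[of "\<lambda>_. 0" Q f] by simp

lemma integrable_scaleR_bounded:
  fixes f :: "'a \<Rightarrow> 'b::{banach,second_countable_topology}"
  assumes "integrable M f" "\<phi> \<in> borel_measurable M" "\<And>x. \<bar>\<phi> x\<bar> \<le> 1"
  shows "integrable M (\<lambda>x. \<phi> x *\<^sub>R f x)"
proof (rule Bochner_Integration.integrable_bound[OF assms(1)])
  show "(\<lambda>x. \<phi> x *\<^sub>R f x) \<in> borel_measurable M" using assms by measurable
  show "AE x in M. norm (\<phi> x *\<^sub>R f x) \<le> norm (f x)"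
    using assms(3) by (auto intro!: AE_I2 mult_left_le_one_le)
qed

lemma avg_set_bounded:
  fixes f :: "real^'d \<Rightarrow> real^'n"
  assumes "integrable lebesgue f"
  shows "bounded (avg_set f Q)"
proof (rule boundedI)
  fix k assume "k \<in> avg_set f Q"
  then obtain \<phi> where \<phi>: "k = (1 / measure lebesgue Q) *\<^sub>R integral\<^sup>L lebesgue (\<lambda>x. \<phi> x *\<^sub>R f x)"
    "\<phi> \<in> borel_measurable lebesgue" "\<And>x. \<bar>\<phi> x\<bar> \<le> 1" unfolding avg_set_def by blast
  have "norm (integral\<^sup>L lebesgue (\<lambda>x. \<phi> x *\<^sub>R f x)) \<le> (LINT x|lebesgue. norm (\<phi> x *\<^sub>R f x))"
    by (rule integral_norm_bound)
  also have "\<dots> \<le> (LINT x|lebesgue. norm (f x))"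
    using integrable_scaleR_bounded[OF assms \<phi>(2,3)] assms \<phi>(3)
    by (intro integral_mono integrable_norm) (auto intro: mult_left_le_one_le)
  finally show "norm k \<le> (1 / measure lebesgue Q) * (LINT x|lebesgue. norm (f x))"
    unfolding \<phi>(1) by (simp add: divide_right_mono)
qed

text \<open>A real \<open>Sup\<close> is informative only for sets bounded above, which boundedness
  of the two bodies ensures.\<close>

lemma set_pair_upper:
  assumes "bounded K" "bounded H" "k \<in> K" "h \<in> H"
  shows "k \<bullet> h \<le> set_pair K H"
proof -
  obtain a b where a: "\<And>x. x \<in> K \<Longrightarrow> norm x \<le> a" and b: "\<And>x. x \<in> H \<Longrightarrow> norm x \<le> b"
    using assms(1,2) unfolding bounded_iff by blast
  have "bdd_above {k \<bullet> h | k h. k \<in> K \<and> h \<in> H}"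
  proof (rule bdd_aboveI[of _ "a * b"], clarify)
    fix k h assume "k \<in> K" "h \<in> H"
    then have "norm k * norm h \<le> a * b"
      using a b by (intro mult_mono) (auto intro: order_trans[OF norm_ge_zero])
    then show "k \<bullet> h \<le> a * b" using norm_cauchy_schwarz order_trans by blast
  qed
  then show ?thesis unfolding set_pair_def using assms(3,4) by (intro cSup_upper) auto
qed

text \<open>The test function is the sign of \<open>w \<bullet> f x\<close> on \<open>Q\<close>. It
  turns the mean of the absolute value into a scalar product with an element of the body, so bounds
  on the body become bounds for scalar means.\<close>

lemma avg_set_inner_attains:
  fixes f :: "real^'d \<Rightarrow> real^'n"
  assumes "integrable lebesgue f" "Q \<in> sets lebesgue"
  obtains k where "k \<in> avg_set f Q" "w \<bullet> k = (LINT x:Q|lebesgue. \<bar>w \<bullet> f x\<bar>) / measure lebesgue Q"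
proof -
  define \<phi> where "\<phi> x = indicator Q x * sgn (w \<bullet> f x)" for x
  have [measurable]: "f \<in> borel_measurable lebesgue" using assms(1) by (rule borel_measurable_integrable)
  have m: "\<phi> \<in> borel_measurable lebesgue" unfolding \<phi>_def[abs_def] using assms(2) by measurable
  have b: "\<bar>\<phi> x\<bar> \<le> 1" for x by (auto simp: \<phi>_def indicator_def abs_sgn_eq)
  have z: "x \<notin> Q \<Longrightarrow> \<phi> x = 0" for x by (simp add: \<phi>_def)
  have "w \<bullet> integral\<^sup>L lebesgue (\<lambda>x. \<phi> x *\<^sub>R f x) = (LINT x|lebesgue. w \<bullet> (\<phi> x *\<^sub>R f x))"
    using integrable_scaleR_bounded[OF assms(1) m b] by (subst integral_inner_right) auto
  also have "\<dots> = (LINT x:Q|lebesgue. \<bar>w \<bullet> f x\<bar>)"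
    unfolding set_lebesgue_integral_def
    by (intro Bochner_Integration.integral_cong refl) (simp add: \<phi>_def abs_sgn mult_ac)
  finally show ?thesis
    using that[OF avg_setI[OF m b z]] by simp
qed

section \<open>Stopping cubes\<close>

text \<open>The weak type bound of the dyadic maximal function for all \<open>u i\<close> at once.
  By Chebyshev's inequality each \<open>i\<close> accounts for at most the fraction
  \<open>1 / A\<close> of \<open>Q0\<close>, and all of them together for \<open>card I / A\<close>,
  which is at most one half.\<close>

lemma CZ_stopping_cubes:
  fixes D :: "(real^'d) set set" and u :: "'i \<Rightarrow> real^'d \<Rightarrow> real"
  assumes D: "dyadic_lattice D" and Q0: "Q0 \<in> D" and I: "finite I"
    and u: "\<And>i. i \<in> I \<Longrightarrow> integrable lebesgue (u i)"
    and A: "1 \<le> A" "2 * real (card I) \<le> A"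
  obtains RR where "RR \<subseteq> D" "\<And>R. R \<in> RR \<Longrightarrow> R \<subseteq> Q0"
    "\<And>R R' x. R \<in> RR \<Longrightarrow> R' \<in> RR \<Longrightarrow> x \<in> R \<Longrightarrow> x \<in> R' \<Longrightarrow> R = R'"
    "\<Union>RR \<in> lmeasurable" "measure lebesgue (\<Union>RR) \<le> measure lebesgue Q0 / 2"
    "\<And>Q i. Q \<in> D \<Longrightarrow> Q \<subseteq> Q0 \<Longrightarrow> (\<And>R. R \<in> RR \<Longrightarrow> \<not> Q \<subseteq> R) \<Longrightarrow> i \<in> I \<Longrightarrow>
       (LINT x:Q|lebesgue. \<bar>u i x\<bar>) \<le> A * cube_avg (\<lambda>x. \<bar>u i x\<bar>) Q0 * measure lebesgue Q"
    "\<And>R i. R \<in> RR \<Longrightarrow> i \<in> I \<Longrightarrow>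
       (LINT x:R|lebesgue. \<bar>u i x\<bar>) \<le> 2^CARD('d) * (A * cube_avg (\<lambda>x. \<bar>u i x\<bar>) Q0) * measure lebesgue R"
proof -
  define J where "J i Q = (LINT x:Q|lebesgue. \<bar>u i x\<bar>)" for i Q
  define c where "c i = A * cube_avg (\<lambda>x. \<bar>u i x\<bar>) Q0" for i
  define bad where "bad R \<longleftrightarrow> (\<exists>i\<in>I. c i * measure lebesgue R < J i R)" for R
  define RR where "RR = {R\<in>D. R \<subseteq> Q0 \<and> bad R \<and> (\<forall>R'\<in>D. R' \<subseteq> Q0 \<longrightarrow> bad R' \<longrightarrow> \<not> R \<subset> R')}"
  have cD: "is_cube Q" "Q \<in> lmeasurable" "Q \<in> sets lebesgue" "0 < measure lebesgue Q" if "Q \<in> D" for Q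
    using lattice_is_cube[OF D that] is_cube_lmeasurable[of Q] is_cube_measure_pos[of Q] by auto
  have J0: "0 \<le> J i Q" for i Q unfolding J_def by (rule set_integral_abs_nonneg)
  have Jmono: "J i Q \<le> J i R" if "Q \<in> D" "R \<in> D" "Q \<subseteq> R" "i \<in> I" for i Q R
    unfolding J_def using that u cD(3) by (intro set_integral_abs_mono_set) auto
  have c_eq: "c i * measure lebesgue Q0 = A * J i Q0" for i
    using cD(4)[OF Q0] by (simp add: c_def cube_avg_def J_def)
  have c0: "0 \<le> c i" for i
    using A J0[of i Q0] by (simp add: c_def cube_avg_def J_def[symmetric])
  have nbadQ0: "\<not> bad Q0"
  proof
    assume "bad Q0"
    then obtain i where "A * J i Q0 < J i Q0" using c_eq by (auto simp: bad_def)
    moreover have "1 * J i Q0 \<le> A * J i Q0" using A J0 by (intro mult_right_mono) auto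
    ultimately show False by simp
  qed
  have maximal: "\<exists>R\<in>RR. Q \<subseteq> R" if Q: "Q \<in> D" "Q \<subseteq> Q0" "bad Q" for Q
  proof -
    \<comment> \<open>The least generation number belongs to the largest bad cube around
      \<open>Q\<close> inside \<open>Q0\<close>.\<close>
    define Z where "Z k \<longleftrightarrow> (\<exists>R\<in>descs k Q0. bad R \<and> Q \<subseteq> R)" for k
    obtain k0 where "Q \<in> descs k0 Q0" using lattice_subset_descs[OF D Q0 Q(1,2)] by blast
    then have "Z k0" using Q by (auto simp: Z_def)
    then have "Z (LEAST k. Z k)" by (rule LeastI)
    then obtain R where R: "R \<in> descs (LEAST k. Z k) Q0" "bad R" "Q \<subseteq> R" by (auto simp: Z_def)
    have RD: "R \<in> D" "R \<subseteq> Q0" using R lattice_descs[OF D Q0] descs_subset by blast+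
    have "\<not> R \<subset> R'" if R': "R' \<in> D" "R' \<subseteq> Q0" "bad R'" for R'
    proof
      assume sub: "R \<subset> R'"
      obtain k where k: "R' \<in> descs k Q0" using lattice_subset_descs[OF D Q0 R'(1,2)] by blast
      have "Q \<subseteq> R'" using R(3) sub by blast
      then have "Z k" unfolding Z_def using k R' by blast
      then have le: "(LEAST k. Z k) \<le> k" by (rule Least_le)
      then have "(2::real) ^ (LEAST k. Z k) \<le> 2 ^ k" by (intro power_increasing) auto
      then have "sidelen R' \<le> sidelen R"
        unfolding descs_sidelen[OF k] descs_sidelen[OF R(1)]
        using is_cube_sidelen_pos[OF cD(1)[OF Q0]] by (intro divide_left_mono) auto
      moreover have "R \<inter> R' \<noteq> {}" using sub is_cube_nonempty[OF cD(1)[OF RD(1)]] by auto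
      ultimately have "R' \<subseteq> R" using lattice_nested[OF D RD(1) R'(1)] by blast
      then show False using sub by blast
    qed
    then have "R \<in> RR" using RD R by (simp add: RR_def)
    then show ?thesis using R by blast
  qed
  have dis: "R = R'" if "R \<in> RR" "R' \<in> RR" "x \<in> R" "x \<in> R'" for R R' x
  proof -
    have "R \<subseteq> R' \<or> R' \<subseteq> R" using lattice_trichotomy[OF D, of R R'] that by (auto simp: RR_def)
    then show ?thesis using that by (auto simp: RR_def)
  qed
  have fin: "measure lebesgue (\<Union>F) \<le> measure lebesgue Q0 / 2" if F: "finite F" "F \<subseteq> RR" for F
  proof -
    have FD: "F \<subseteq> D" using F by (auto simp: RR_def)
    have R_le: "measure lebesgue R \<le> (\<Sum>i\<in>I. J i R / c i)" if R: "R \<in> F" for R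
    proof -
      have RD: "R \<in> D" "R \<subseteq> Q0" "bad R" using R F by (auto simp: RR_def)
      then obtain i where i: "i \<in> I" "c i * measure lebesgue R < J i R" by (auto simp: bad_def)
      \<comment> \<open>A vanishing threshold means that \<open>u i\<close> has no mass on
        \<open>Q0\<close>, and then the strict inequality in \<open>bad\<close> cannot hold for this
        \<open>i\<close>.\<close>
      have "0 < c i"
      proof (rule ccontr)
        assume "\<not> 0 < c i"
        then have "c i = 0" using c0[of i] by linarith
        then have "J i Q0 = 0" using c_eq[of i] A by simp
        then have "J i R \<le> 0" using Jmono[OF RD(1) Q0 RD(2) i(1)] by simp
        then show False using i \<open>c i = 0\<close> by simp
      qed
      then have "measure lebesgue R \<le> J i R / c i" using i(2) by (simp add: field_simps)
      also have "\<dots> \<le> (\<Sum>i\<in>I. J i R / c i)"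
        using i(1) I J0 c0 by (intro member_le_sum[of i]) auto
      finally show ?thesis .
    qed
    have "measure lebesgue (\<Union>F) \<le> (\<Sum>R\<in>F. measure lebesgue R)"
      using F FD cD(2) by (intro measure_Union_le) auto
    also have "\<dots> \<le> (\<Sum>R\<in>F. \<Sum>i\<in>I. J i R / c i)" by (intro sum_mono R_le)
    also have "\<dots> = (\<Sum>i\<in>I. (\<Sum>R\<in>F. J i R) / c i)"
      by (subst sum.swap) (simp add: sum_divide_distrib)
    also have "\<dots> \<le> (\<Sum>i\<in>I. measure lebesgue Q0 / A)"
    proof (rule sum_mono)
      fix i assume i: "i \<in> I"
      have "(\<Sum>R\<in>F. J i R) = (LINT x:\<Union>F|lebesgue. \<bar>u i x\<bar>)"
        unfolding J_def
      proof (rule sum_set_integral_disjoint[OF F(1)])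
        show "F \<subseteq> sets lebesgue" using FD cD(3) by blast
        show "integrable lebesgue (\<lambda>x. \<bar>u i x\<bar>)" using u[OF i] by simp
        show "R = R'" if "R \<in> F" "R' \<in> F" "x \<in> R" "x \<in> R'" for R R' x
          using dis[of R R' x] that F(2) by blast
      qed
      also have "\<dots> \<le> J i Q0"
        unfolding J_def
      proof (rule set_integral_abs_mono_set[OF _ cD(3)[OF Q0] u[OF i]])
        show "\<Union>F \<in> sets lebesgue" using F(1) FD cD(3) by (intro sets.finite_Union) auto
        show "\<Union>F \<subseteq> Q0" using F(2) by (auto simp: RR_def)
      qed
      finally have le: "(\<Sum>R\<in>F. J i R) \<le> J i Q0" .
      show "(\<Sum>R\<in>F. J i R) / c i \<le> measure lebesgue Q0 / A"
      proof (cases "c i = 0")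
        \<comment> \<open>Division by zero gives 0, so such an \<open>i\<close> contributes nothing
          to the sum.\<close>
        case True
        then show ?thesis using A by simp
      next
        case False
        then have ci: "0 < c i" using c0[of i] by linarith
        have "(\<Sum>R\<in>F. J i R) / c i \<le> J i Q0 / c i" using le ci by (intro divide_right_mono) auto
        also have "\<dots> = measure lebesgue Q0 / A" using c_eq[of i] ci A by (simp add: field_simps)
        finally show ?thesis .
      qed
    qed
    also have "\<dots> = real (card I) / A * measure lebesgue Q0" by simp
    also have "\<dots> \<le> 1 / 2 * measure lebesgue Q0"
      using A by (intro mult_right_mono) (auto simp: field_simps)
    finally show ?thesis by simp
  qed
  \<comment> \<open>\<open>RR\<close> may be infinite. Its cubes of generation at most
    \<open>n\<close> form finite subfamilies whose unions increase to \<open>\<Union>RR\<close>, so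
    the finite estimate passes to the limit.\<close>
  define S where "S n = \<Union>(RR \<inter> (\<Union>k\<le>n. descs k Q0))" for n :: nat
  have Sm: "S n \<in> lmeasurable" for n
    unfolding S_def using cD(2)
    by (intro fmeasurable.finite_Union) (auto simp: RR_def finite_descs)
  have S_le: "measure lebesgue (\<Union>i\<le>n. S i) \<le> measure lebesgue Q0 / 2" for n
  proof -
    have "(\<Union>i\<le>n. S i) = S n" unfolding S_def by (fastforce intro: le_trans)
    moreover have "measure lebesgue (S n) \<le> measure lebesgue Q0 / 2"
      unfolding S_def by (rule fin) (auto simp: finite_descs)
    ultimately show ?thesis by simp
  qed
  have SU: "(\<Union>i. S i) = \<Union>RR"
  proof -
    have "\<exists>k. R \<in> descs k Q0" if "R \<in> RR" for R
      using lattice_subset_descs[OF D Q0] that by (auto simp: RR_def)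
    then show ?thesis unfolding S_def by fastforce
  qed
  have good: "J i Q \<le> c i * measure lebesgue Q" if "\<not> bad Q" "i \<in> I" for Q i
    using that by (auto simp: bad_def not_less)
  show ?thesis
  proof (rule that[of RR])
    show "RR \<subseteq> D" "\<And>R. R \<in> RR \<Longrightarrow> R \<subseteq> Q0" by (auto simp: RR_def)
    show "R = R'" if "R \<in> RR" "R' \<in> RR" "x \<in> R" "x \<in> R'" for R R' x using dis[OF that] .
    show "\<Union>RR \<in> lmeasurable" using fmeasurable_countable_Union[OF Sm S_le] SU by simp
    show "measure lebesgue (\<Union>RR) \<le> measure lebesgue Q0 / 2"
      using measure_countable_Union_le[OF Sm S_le] SU by simp
  next
    fix Q i assume Q: "Q \<in> D" "Q \<subseteq> Q0" "\<And>R. R \<in> RR \<Longrightarrow> \<not> Q \<subseteq> R" "i \<in> I"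
    then have "\<not> bad Q" using maximal by blast
    from good[OF this Q(4)]
    show "(LINT x:Q|lebesgue. \<bar>u i x\<bar>) \<le> A * cube_avg (\<lambda>x. \<bar>u i x\<bar>) Q0 * measure lebesgue Q"
      by (simp add: J_def c_def)
  next
    fix R i assume R: "R \<in> RR" and i: "i \<in> I"
    have RD: "R \<in> D" "R \<subseteq> Q0" "bad R" using R by (auto simp: RR_def)
    obtain k where k: "R \<in> descs k Q0" using lattice_subset_descs[OF D Q0 RD(1,2)] by blast
    \<comment> \<open>\<open>Q0\<close> is not bad, as \<open>A\<close> is at least 1, so a stopping
      cube has a parent inside \<open>Q0\<close>. By maximality the parent is not bad, and passing
      to the child costs the volume ratio \<open>2^CARD('d)\<close>.\<close>
    have "k \<noteq> 0" using k nbadQ0 RD(3) by (cases k) auto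
    then obtain j where j: "k = j + 1" by (metis add.commute Suc_eq_plus1 not0_implies_Suc)
    then obtain T where T: "T \<in> descs j Q0" "R \<in> descs 1 T"
      using k descs_add[of R j 1 Q0] by blast
    have TD: "T \<in> D" "T \<subseteq> Q0" using lattice_descs[OF D Q0 T(1)] descs_subset[OF T(1)] by auto
    have mT: "measure lebesgue T = 2^CARD('d) * measure lebesgue R"
      using descs_measure[OF cD(1)[OF TD(1)] T(2)] by simp
    have "R \<subset> T"
    proof -
      have "R \<noteq> T"
        using descs_sidelen[OF T(2)] is_cube_sidelen_pos[OF cD(1)[OF TD(1)]] by auto
      then show ?thesis using descs_subset[OF T(2)] by blast
    qed
    then have "\<not> bad T" using R TD by (auto simp: RR_def)
    then have "J i T \<le> c i * measure lebesgue T" using good i by blast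
    moreover have "J i R \<le> J i T" using Jmono[OF RD(1) TD(1) _ i] \<open>R \<subset> T\<close> by blast
    ultimately have "J i R \<le> 2^CARD('d) * c i * measure lebesgue R" unfolding mT by (simp add: mult_ac)
    then show "(LINT x:R|lebesgue. \<bar>u i x\<bar>) \<le> 2^CARD('d) * (A * cube_avg (\<lambda>x. \<bar>u i x\<bar>) Q0) * measure lebesgue R"
      by (simp add: J_def c_def)
  qed
qed

text \<open>The indicator of \<open>R \<inter> Q0\<close> is an admissible test function. Integrals
  over cells thus become multiples of elements of the body, where the expansion of
  \<open>approx_Auerbach\<close> is available.\<close>

lemma integral_on_subset_in_avg_set:
  fixes f :: "real^'d \<Rightarrow> real^'n"
  assumes "is_cube Q0" "R \<in> sets lebesgue"
  obtains k where "k \<in> avg_set f Q0"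
    "(LINT x:R \<inter> Q0|lebesgue. f x) = measure lebesgue Q0 *\<^sub>R k"
proof -
  have Q0: "Q0 \<in> sets lebesgue" "0 < measure lebesgue Q0"
    using is_cube_lmeasurable[OF assms(1)] is_cube_measure_pos[OF assms(1)] by auto
  show ?thesis
  proof (rule that)
    show "(1 / measure lebesgue Q0) *\<^sub>R (LINT x|lebesgue. indicator (R \<inter> Q0) x *\<^sub>R f x) \<in> avg_set f Q0"
      using Q0 assms(2) by (intro avg_setI) (auto simp: indicator_def)
    show "(LINT x:R \<inter> Q0|lebesgue. f x) = measure lebesgue Q0 *\<^sub>R
        ((1 / measure lebesgue Q0) *\<^sub>R (LINT x|lebesgue. indicator (R \<inter> Q0) x *\<^sub>R f x))"
      using Q0(2) by (simp add: set_lebesgue_integral_def)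
  qed
qed

text \<open>The expansion is known only on the body, which may lie in a proper subspace. It is
  therefore applied to the integrals of \<open>f1\<close> over cells and not to the values of
  \<open>f1\<close>; on each pair of cells the form is a multiple of the dot product of two such
  integrals.\<close>

lemma cube_form_vec_eq:
  fixes D :: "(real^'d) set set" and f1 f2 :: "real^'d \<Rightarrow> real^'n"
  assumes D: "dyadic_lattice D" and s: "dyadic_shift D m1 m2 s" and Q: "Q \<in> D" and Q0: "is_cube Q0"
    and f: "integrable lebesgue f1" "integrable lebesgue f2"
    and loc: "Q \<subseteq> Q0 \<or> (\<forall>x. x \<notin> Q0 \<longrightarrow> f1 x = 0 \<and> f2 x = 0)"
    and rep: "\<And>k. k \<in> avg_set f1 Q0 \<Longrightarrow> k = (\<Sum>i<N. (w i \<bullet> k) *\<^sub>R b i)"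
  shows "(\<Sum>j\<in>UNIV. cube_form s Q (\<lambda>x. f1 x $ j) (\<lambda>x. f2 x $ j))
    = (\<Sum>i<N. cube_form s Q (\<lambda>x. indicator Q0 x * (w i \<bullet> f1 x)) (\<lambda>x. indicator Q0 x * (b i \<bullet> f2 x)))"
proof -
  obtain c where c: "\<And>u v. integrable lebesgue u \<Longrightarrow> integrable lebesgue v \<Longrightarrow>
      cube_form s Q u v = (\<Sum>R1\<in>descs (Suc m1) Q. \<Sum>R2\<in>descs (Suc m2) Q.
        c R1 R2 * ((LINT x:R1|lebesgue. u x) * (LINT x:R2|lebesgue. v x)))"
    by (rule cube_form_descs[OF D s Q]) blast
  have Q0m: "Q0 \<in> sets lebesgue" using is_cube_lmeasurable[OF Q0] by auto
  define F1 where "F1 R = (LINT x:R \<inter> Q0|lebesgue. f1 x)" for R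
  define F2 where "F2 R = (LINT x:R \<inter> Q0|lebesgue. f2 x)" for R
  have cell: "R \<in> sets lebesgue" "R \<subseteq> Q" if "R \<in> descs k Q" for R k
    using is_cube_lmeasurable[OF lattice_is_cube[OF D lattice_descs[OF D Q that]]] descs_subset[OF that]
    by auto
  \<comment> \<open>By \<open>loc\<close> the cutoff to \<open>Q0\<close> is invisible on
    \<open>Q\<close>: either \<open>Q\<close> lies in \<open>Q0\<close>, or both functions vanish
    outside \<open>Q0\<close>.\<close>
  have ind: "indicator R x *\<^sub>R f1 x = indicator (R \<inter> Q0) x *\<^sub>R f1 x"
    "indicator R x *\<^sub>R f2 x = indicator (R \<inter> Q0) x *\<^sub>R f2 x" if "R \<subseteq> Q" for R x
    using loc that by (auto simp: indicator_def)
  have comp: "(LINT x:R|lebesgue. f1 x $ j) = F1 R $ j" "(LINT x:R|lebesgue. f2 x $ j) = F2 R $ j"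
    if "R \<in> descs k Q" for R k j
  proof -
    note Rm = cell(1)[OF that]
    have "(LINT x:R|lebesgue. f x $ j) = (LINT x:R \<inter> Q0|lebesgue. f x) $ j"
      if f: "integrable lebesgue f" and eq: "\<And>x. indicator R x *\<^sub>R f x = indicator (R \<inter> Q0) x *\<^sub>R f x"
      for f :: "real^'d \<Rightarrow> real^'n"
    proof -
      have "(LINT x:R|lebesgue. f x $ j) = (LINT x|lebesgue. (indicator R x *\<^sub>R f x) $ j)"
        by (simp add: set_lebesgue_integral_def)
      also have "\<dots> = (LINT x|lebesgue. indicator R x *\<^sub>R f x) $ j"
        by (intro integral_bounded_linear[OF bounded_linear_vec_nth] integrable_mult_indicator Rm f)
      finally show ?thesis by (simp only: eq set_lebesgue_integral_def)
    qed
    then show "(LINT x:R|lebesgue. f1 x $ j) = F1 R $ j" "(LINT x:R|lebesgue. f2 x $ j) = F2 R $ j"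
      unfolding F1_def F2_def using f ind[OF cell(2)[OF that]] by blast+
  qed
  have inner: "(LINT x:R|lebesgue. indicator Q0 x * (a \<bullet> f x)) = a \<bullet> (LINT x:R \<inter> Q0|lebesgue. f x)"
    if "R \<in> descs k Q" "integrable lebesgue f" for R k a and f :: "real^'d \<Rightarrow> real^'n"
  proof -
    have "(LINT x:R|lebesgue. indicator Q0 x * (a \<bullet> f x)) = (LINT x|lebesgue. a \<bullet> (indicator (R \<inter> Q0) x *\<^sub>R f x))"
      unfolding set_lebesgue_integral_def
      by (intro Bochner_Integration.integral_cong refl) (auto simp: indicator_def)
    also have "\<dots> = a \<bullet> (LINT x:R \<inter> Q0|lebesgue. f x)"
      unfolding set_lebesgue_integral_def
      using integrable_mult_indicator[OF sets.Int[OF cell(1)[OF that(1)] Q0m] that(2)]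
      by (subst integral_inner_right) auto
    finally show ?thesis .
  qed
  have dot: "F1 R1 \<bullet> F2 R2 = (\<Sum>i<N. (w i \<bullet> F1 R1) * (b i \<bullet> F2 R2))" if "R1 \<in> descs k Q" for R1 R2 k
  proof -
    note Rm = cell(1)[OF that]
    obtain \<kappa> where \<kappa>: "\<kappa> \<in> avg_set f1 Q0" "F1 R1 = measure lebesgue Q0 *\<^sub>R \<kappa>"
      unfolding F1_def by (rule integral_on_subset_in_avg_set[OF Q0 Rm])
    have "F1 R1 = measure lebesgue Q0 *\<^sub>R (\<Sum>i<N. (w i \<bullet> \<kappa>) *\<^sub>R b i)"
      using rep[OF \<kappa>(1)] \<kappa>(2) by simp
    also have "\<dots> = (\<Sum>i<N. (w i \<bullet> F1 R1) *\<^sub>R b i)"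
      by (simp add: \<kappa>(2) scaleR_sum_right)
    finally have "F1 R1 \<bullet> F2 R2 = (\<Sum>i<N. (w i \<bullet> F1 R1) *\<^sub>R b i) \<bullet> F2 R2" by simp
    then show ?thesis by (simp add: inner_sum_left)
  qed
  have "(\<Sum>j\<in>UNIV. cube_form s Q (\<lambda>x. f1 x $ j) (\<lambda>x. f2 x $ j))
      = (\<Sum>j\<in>UNIV. \<Sum>R1\<in>descs (Suc m1) Q. \<Sum>R2\<in>descs (Suc m2) Q. c R1 R2 * (F1 R1 $ j * F2 R2 $ j))"
  proof (rule sum.cong[OF refl])
    fix j
    have "integrable lebesgue (\<lambda>x. f1 x $ j)" "integrable lebesgue (\<lambda>x. f2 x $ j)"
      using f by (auto intro: integrable_bounded_linear[OF bounded_linear_vec_nth])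
    then show "cube_form s Q (\<lambda>x. f1 x $ j) (\<lambda>x. f2 x $ j)
        = (\<Sum>R1\<in>descs (Suc m1) Q. \<Sum>R2\<in>descs (Suc m2) Q. c R1 R2 * (F1 R1 $ j * F2 R2 $ j))"
      by (simp add: c comp cong: sum.cong)
  qed
  also have "\<dots> = (\<Sum>R1\<in>descs (Suc m1) Q. \<Sum>R2\<in>descs (Suc m2) Q. \<Sum>j\<in>UNIV. c R1 R2 * (F1 R1 $ j * F2 R2 $ j))"
    by (subst sum.swap, intro sum.cong refl, subst sum.swap, rule refl)
  also have "\<dots> = (\<Sum>R1\<in>descs (Suc m1) Q. \<Sum>R2\<in>descs (Suc m2) Q.
      \<Sum>i<N. c R1 R2 * ((w i \<bullet> F1 R1) * (b i \<bullet> F2 R2)))"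
  proof (intro sum.cong refl)
    fix R1 R2 assume "R1 \<in> descs (Suc m1) Q"
    then show "(\<Sum>j\<in>UNIV. c R1 R2 * (F1 R1 $ j * F2 R2 $ j)) = (\<Sum>i<N. c R1 R2 * ((w i \<bullet> F1 R1) * (b i \<bullet> F2 R2)))"
      using dot[of R1 "Suc m1" R2] by (simp add: sum_distrib_left[symmetric] inner_vec_def)
  qed
  also have "\<dots> = (\<Sum>i<N. \<Sum>R1\<in>descs (Suc m1) Q. \<Sum>R2\<in>descs (Suc m2) Q.
      c R1 R2 * ((w i \<bullet> F1 R1) * (b i \<bullet> F2 R2)))"
    by (subst (2) sum.swap, intro sum.cong refl, subst sum.swap, rule refl)
  also have "\<dots> = (\<Sum>i<N. cube_form s Q (\<lambda>x. indicator Q0 x * (w i \<bullet> f1 x)) (\<lambda>x. indicator Q0 x * (b i \<bullet> f2 x)))"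
  proof (rule sum.cong[OF refl])
    fix i
    have "integrable lebesgue (\<lambda>x. indicator Q0 x * (w i \<bullet> f1 x))"
      "integrable lebesgue (\<lambda>x. indicator Q0 x * (b i \<bullet> f2 x))"
      using f Q0m by (auto intro!: integrable_indicator_times)
    then show "(\<Sum>R1\<in>descs (Suc m1) Q. \<Sum>R2\<in>descs (Suc m2) Q. c R1 R2 * ((w i \<bullet> F1 R1) * (b i \<bullet> F2 R2)))
      = cube_form s Q (\<lambda>x. indicator Q0 x * (w i \<bullet> f1 x)) (\<lambda>x. indicator Q0 x * (b i \<bullet> f2 x))"
      by (simp add: c inner f F1_def F2_def cong: sum.cong)
  qed
  finally show ?thesis .
qed

text \<open>Only finitely many cubes of the shift matter, so the stopping cubes can be completed to a
  finite partition of Q0 by small cubes on which every relevant average is still controlled; no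
  Lebesgue differentiation is needed.\<close>

lemma CZ_finite_partition:
  fixes D :: "(real^'d) set set"
  assumes D: "dyadic_lattice D" and Q0: "Q0 \<in> D" and F: "finite F" "F \<subseteq> D"
    and RR: "RR \<subseteq> D" "\<And>R. R \<in> RR \<Longrightarrow> R \<subseteq> Q0"
    and dis: "\<And>R R' x. R \<in> RR \<Longrightarrow> R' \<in> RR \<Longrightarrow> x \<in> R \<Longrightarrow> x \<in> R' \<Longrightarrow> R = R'"
    and FR: "\<And>Q R. Q \<in> F \<Longrightarrow> R \<in> RR \<Longrightarrow> \<not> Q \<subseteq> R"
  obtains PP where "finite PP" "PP \<subseteq> D" "\<Union>PP = Q0"
    "\<And>P P' x. P \<in> PP \<Longrightarrow> P' \<in> PP \<Longrightarrow> x \<in> P \<Longrightarrow> x \<in> P' \<Longrightarrow> P = P'"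
    "\<And>P. P \<in> PP \<Longrightarrow> P \<in> RR \<or> (\<forall>R\<in>RR. \<not> P \<subseteq> R)"
    "\<And>Q P. Q \<in> F \<Longrightarrow> P \<in> PP \<Longrightarrow> \<not> Q \<subset> P"
    "(\<Sum>P\<in>PP. measure lebesgue P) = measure lebesgue Q0"
proof -
  have cD: "is_cube Q" if "Q \<in> D" for Q using lattice_is_cube[OF D that] .
  define \<kappa> where "\<kappa> Q = (SOME k. Q \<in> descs k Q0)" for Q
  have \<kappa>: "Q \<in> descs (\<kappa> Q) Q0" if "Q \<in> F" "Q \<subseteq> Q0" for Q
    unfolding \<kappa>_def by (rule someI_ex) (use lattice_subset_descs[OF D Q0] F(2) that in blast)
  \<comment> \<open>A convenient upper bound for the generations of all cubes of \<open>F\<close>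
    inside \<open>Q0\<close>.\<close>
  define N where "N = sum \<kappa> F"
  have len0: "0 < sidelen Q0" using is_cube_sidelen_pos[OF cD[OF Q0]] .
  have len_mono: "sidelen P \<le> sidelen R" if "P \<in> descs j Q0" "R \<in> descs k Q0" "k \<le> j" for P R j k
  proof -
    have "(2::real)^k \<le> 2^j" using that(3) by (intro power_increasing) auto
    then show ?thesis
      unfolding descs_sidelen[OF that(1)] descs_sidelen[OF that(2)]
      using len0 by (intro divide_left_mono) auto
  qed
  \<comment> \<open>Stopping cubes deeper than generation \<open>N\<close> are dropped. The cube of
    generation \<open>N\<close> around one of them lies in no stopping cube and takes its
    place.\<close>
  define PP where "PP = {R\<in>RR. \<exists>k\<le>N. R \<in> descs k Q0} \<union> {P\<in>descs N Q0. \<forall>R\<in>RR. \<not> P \<subseteq> R}"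
  have fin: "finite PP"
  proof -
    have "PP \<subseteq> (\<Union>k\<le>N. descs k Q0)" by (auto simp: PP_def)
    then show ?thesis by (rule finite_subset) (simp add: finite_descs)
  qed
  have PPD: "PP \<subseteq> D" using RR(1) lattice_descs[OF D Q0] by (auto simp: PP_def)
  have PPsub: "P \<subseteq> Q0" if "P \<in> PP" for P using that RR(2) descs_subset[of P N Q0] by (auto simp: PP_def)
  have mixed: False if "R \<in> RR" "k \<le> N" "R \<in> descs k Q0" "P \<in> descs N Q0" "\<forall>R\<in>RR. \<not> P \<subseteq> R"
    "x \<in> R" "x \<in> P" for R P x k
  proof -
    have "P \<subseteq> R"
      using lattice_nested[OF D, of R P] that len_mono[OF that(4,3,2)] RR(1) lattice_descs[OF D Q0] by blast
    then show False using that by blast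
  qed
  have PPdis: "P = P'" if "P \<in> PP" "P' \<in> PP" "x \<in> P" "x \<in> P'" for P P' x
    using that unfolding PP_def
    by (elim UnE CollectE conjE exE) (blast dest: dis mixed descs_disjoint)+
  have cover: "\<exists>P\<in>PP. x \<in> P" if x: "x \<in> Q0" for x
  proof -
    obtain P where P: "P \<in> descs N Q0" "x \<in> P" using descs_cover[OF cD[OF Q0] x] by blast
    show ?thesis
    proof (cases "\<exists>R\<in>RR. P \<subseteq> R")
      case True
      then obtain R where R: "R \<in> RR" "P \<subseteq> R" by blast
      obtain k where k: "R \<in> descs k Q0" using lattice_subset_descs[OF D Q0] R RR by blast
      have "sidelen P \<le> sidelen R"
        using is_cube_subset_sidelen R RR(1) cD lattice_descs[OF D Q0 P(1)] by blast
      then have "sidelen Q0 / 2^N \<le> sidelen Q0 / 2^k"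
        unfolding descs_sidelen[OF P(1)] descs_sidelen[OF k] .
      then have "(2::real)^k \<le> 2^N" using len0 by (simp add: field_simps)
      then have "k \<le> N" by simp
      then have "R \<in> PP" using R k by (auto simp: PP_def)
      then show ?thesis using R P by blast
    next
      case False
      then have "P \<in> PP" using P by (auto simp: PP_def)
      then show ?thesis using P by blast
    qed
  qed
  have Un: "\<Union>PP = Q0" using cover PPsub by blast
  show ?thesis
  proof (rule that[OF fin PPD Un])
    show "P = P'" if "P \<in> PP" "P' \<in> PP" "x \<in> P" "x \<in> P'" for P P' x using PPdis[OF that] .
    show "P \<in> RR \<or> (\<forall>R\<in>RR. \<not> P \<subseteq> R)" if "P \<in> PP" for P using that by (auto simp: PP_def)
    show "\<not> Q \<subset> P" if Q: "Q \<in> F" and P: "P \<in> PP" for Q P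
    proof
      assume sub: "Q \<subset> P"
      then have k: "Q \<in> descs (\<kappa> Q) Q0" using \<kappa>[OF Q] PPsub[OF P] by blast
      \<comment> \<open>A cube of \<open>F\<close> lies in no stopping cube, so \<open>P\<close>
        comes from generation \<open>N\<close>, which is too deep for \<open>Q\<close> to fit
        strictly inside.\<close>
      have "P \<notin> RR" using FR[OF Q] sub by blast
      then have PN: "P \<in> descs N Q0" using P by (auto simp: PP_def)
      have "\<kappa> Q \<le> N" unfolding N_def using Q F(1) by (intro member_le_sum) auto
      then have "sidelen P \<le> sidelen Q" using len_mono[OF PN k] by blast
      moreover have "Q \<inter> P \<noteq> {}" using sub is_cube_nonempty cD F(2) Q by blast
      ultimately have "P \<subseteq> Q" using lattice_nested[OF D, of Q P] F(2) Q PPD P by blast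
      then show False using sub by blast
    qed
    have "measure lebesgue (\<Union>PP) = (\<Sum>P\<in>PP. measure lebesgue P)"
    proof (rule measure_Union'[OF fin])
      show "P \<in> lmeasurable" if "P \<in> PP" for P using that PPD is_cube_lmeasurable cD by blast
      show "pairwise disjnt PP" unfolding pairwise_def disjnt_iff using PPdis by blast
    qed
    then show "(\<Sum>P\<in>PP. measure lebesgue P) = measure lebesgue Q0" using Un by simp
  qed
qed

text \<open>A cube that is not inside \<open>Q0\<close> either contains \<open>Q0\<close>, which
  only dilutes the mean, or misses it.\<close>

lemma set_integral_cutoff_le:
  fixes v :: "real^'d \<Rightarrow> real"
  assumes "dyadic_lattice D" "Q0 \<in> D" "Q \<in> D" "\<not> Q \<subseteq> Q0" "integrable lebesgue v"
    "\<And>x. x \<notin> Q0 \<Longrightarrow> v x = 0"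
  shows "(LINT x:Q|lebesgue. \<bar>v x\<bar>) \<le> cube_avg (\<lambda>x. \<bar>v x\<bar>) Q0 * measure lebesgue Q"
proof -
  have c: "is_cube Q" "is_cube Q0" using assms lattice_is_cube by blast+
  have avg0: "0 \<le> cube_avg (\<lambda>x. \<bar>v x\<bar>) Q0"
    unfolding cube_avg_def by (simp add: set_integral_abs_nonneg)
  consider "Q0 \<subseteq> Q" | "Q \<inter> Q0 = {}" using lattice_trichotomy[OF assms(1,3,2)] assms(4) by blast
  then show ?thesis
  proof cases
    case 1
    have "indicator Q x *\<^sub>R \<bar>v x\<bar> = indicator Q0 x *\<^sub>R \<bar>v x\<bar>" for x
      using 1 assms(6)[of x] by (auto simp: indicator_def)
    then have "(LINT x:Q|lebesgue. \<bar>v x\<bar>) = (LINT x:Q0|lebesgue. \<bar>v x\<bar>)"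
      unfolding set_lebesgue_integral_def by (simp only:)
    also have "\<dots> = cube_avg (\<lambda>x. \<bar>v x\<bar>) Q0 * measure lebesgue Q0"
      using is_cube_measure_pos[OF c(2)] by (simp add: cube_avg_def)
    also have "\<dots> \<le> cube_avg (\<lambda>x. \<bar>v x\<bar>) Q0 * measure lebesgue Q"
      using avg0 1 is_cube_lmeasurable[OF c(1)] is_cube_lmeasurable[OF c(2)]
      by (intro mult_left_mono measure_mono_fmeasurable) auto
    finally show ?thesis .
  next
    case 2
    then have "indicator Q x *\<^sub>R \<bar>v x\<bar> = 0" for x
      using assms(6)[of x] by (auto simp: indicator_def)
    then have "(LINT x:Q|lebesgue. \<bar>v x\<bar>) = 0"
      unfolding set_lebesgue_integral_def by (simp only: Bochner_Integration.integral_zero)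
    then show ?thesis using avg0 by simp
  qed
qed

text \<open>The alternative on the support lets the top cube also absorb all cubes not contained in it.\<close>

definition stopping_family ::
  "(real^'d) set set \<Rightarrow> (real^'d \<Rightarrow> real^'n) \<Rightarrow> (real^'d \<Rightarrow> real^'n) \<Rightarrow> real \<Rightarrow> (real^'d) set \<Rightarrow> (real^'d) set set \<Rightarrow> bool" where
  "stopping_family D f1 f2 C Q0 RR \<longleftrightarrow> RR \<subseteq> D \<and> (\<forall>R\<in>RR. R \<subseteq> Q0)
    \<and> (\<forall>R\<in>RR. \<forall>R'\<in>RR. R \<inter> R' \<noteq> {} \<longrightarrow> R = R')
    \<and> \<Union>RR \<in> lmeasurable \<and> measure lebesgue (\<Union>RR) \<le> measure lebesgue Q0 / 2
    \<and> (\<forall>m1 m2 s QQ. dyadic_shift D m1 m2 s \<longrightarrow> QQ \<subseteq> D \<longrightarrow> (\<forall>Q\<in>QQ. \<forall>R\<in>RR. \<not> Q \<subseteq> R) \<longrightarrow>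
         ((\<forall>Q\<in>QQ. Q \<subseteq> Q0) \<or> (\<forall>x. x \<notin> Q0 \<longrightarrow> f1 x = 0 \<and> f2 x = 0)) \<longrightarrow>
         \<bar>shift_form_vec QQ s f1 f2\<bar> \<le> C * real (max 1 (max m1 m2)) *
            (measure lebesgue Q0 * set_pair (avg_set f1 Q0) (avg_set f2 Q0)))"

text \<open>The estimate on one cube. On \<open>Q0\<close> the means of the \<open>g i\<close> are
  at most \<open>CA\<close> and those of the \<open>h i\<close> at most the pairing of the two
  bodies; the scalar estimate multiplies them, so the scalar forms add up to a multiple of the term
  of \<open>Q0\<close> in the sparse sum.\<close>

lemma ex_stopping_family:
  "\<exists>C\<ge>0. \<forall>(f1::real^'d \<Rightarrow> real^'n) f2 D Q0. integrable lebesgue f1 \<longrightarrow> integrable lebesgue f2 \<longrightarrow>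
     dyadic_lattice D \<longrightarrow> Q0 \<in> D \<longrightarrow> (\<exists>RR. stopping_family D f1 f2 C Q0 RR)"
proof -
  define n where "n = CARD('n)"
  have n: "1 \<le> n" unfolding n_def using zero_less_card_finite[where 'a='n] by linarith
  obtain CA where CA: "0 \<le> CA" and aux: "\<forall>K::(real^'n) set. 0 \<in> K \<and> bounded K \<and> dim K \<le> n \<longrightarrow>
     (\<exists>b w. (\<forall>i<n. b i \<in> K) \<and> (\<forall>k\<in>K. k = (\<Sum>i<n. (w i \<bullet> k) *\<^sub>R b i)) \<and> (\<forall>i<n. \<forall>k\<in>K. \<bar>w i \<bullet> k\<bar> \<le> CA))"
    using approx_Auerbach[of n, where 'a="real^'n"] by (elim exE conjE) (rule that)
  \<comment> \<open>Twice the number \<open>2 * n\<close> of functions \<open>g i\<close> and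
    \<open>h i\<close>.\<close>
  define A where "A = 4 * real n"
  have A: "1 \<le> A" using n by (simp add: A_def)
  \<comment> \<open>One threshold for both kinds of cubes: \<open>A\<close> suffices on cubes inside
    no stopping cube, while stopping cubes lose the factor \<open>2^CARD('d)\<close> to their
    parents.\<close>
  define B where "B = 2^CARD('d) * A"
  have AB: "A \<le> B" "0 \<le> B" using A by (auto simp: B_def)
  \<comment> \<open>There are \<open>n\<close> scalar forms. The 9 bounds
    \<open>5 + 2 * m1 + 2 * m2\<close> in units of the complexity, \<open>B * CA\<close> bounds the
    means of \<open>g i\<close>, and \<open>B\<close> times the pairing those of
    \<open>h i\<close>.\<close>
  define C where "C = real n * (9 * (B * CA * B))"
  have C: "0 \<le> C" using CA AB by (simp add: C_def)
  show ?thesis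
  proof (intro exI[of _ C] conjI C allI impI)
    fix f1 f2 :: "real^'d \<Rightarrow> real^'n" and D and Q0 :: "(real^'d) set"
    assume f: "integrable lebesgue f1" "integrable lebesgue f2" and D: "dyadic_lattice D" and Q0: "Q0 \<in> D"
    let ?K = "avg_set f1 Q0" and ?H = "avg_set f2 Q0"
    define \<sigma> where "\<sigma> = set_pair ?K ?H"
    have cQ0: "is_cube Q0" "Q0 \<in> sets lebesgue" "0 < measure lebesgue Q0"
      using lattice_is_cube[OF D Q0] is_cube_lmeasurable[of Q0] is_cube_measure_pos[of Q0] by auto
    have K: "bounded ?K" "bounded ?H" using avg_set_bounded f by blast+
    have "dim ?K \<le> n" using dim_subset_UNIV[of ?K] by (simp add: n_def)
    then have "0 \<in> ?K \<and> bounded ?K \<and> dim ?K \<le> n" using zero_in_avg_set[of f1 Q0] K(1) by blast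
    from aux[rule_format, OF this] obtain b w where b: "\<forall>i<n. b i \<in> ?K"
      and rep: "\<forall>k\<in>?K. k = (\<Sum>i<n. (w i \<bullet> k) *\<^sub>R b i)" and w: "\<forall>i<n. \<forall>k\<in>?K. \<bar>w i \<bullet> k\<bar> \<le> CA"
      by (elim exE conjE) (rule that)
    define g where "g i x = indicator Q0 x * (w i \<bullet> f1 x)" for i x
    define h where "h i x = indicator Q0 x * (b i \<bullet> f2 x)" for i x
    have ig: "integrable lebesgue (g i)" and ih: "integrable lebesgue (h i)" for i
      unfolding g_def[abs_def] h_def[abs_def] using f cQ0(2) by (auto intro!: integrable_indicator_times)
    have g0: "g i x = 0" and h0: "h i x = 0" if "x \<notin> Q0" for i x using that by (auto simp: g_def h_def)
    define ag where "ag i = cube_avg (\<lambda>x. \<bar>g i x\<bar>) Q0" for i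
    define ah where "ah i = cube_avg (\<lambda>x. \<bar>h i x\<bar>) Q0" for i
    have avg_cut: "cube_avg (\<lambda>x. \<bar>indicator Q0 x * (a \<bullet> f x)\<bar>) Q0 = (LINT x:Q0|lebesgue. \<bar>a \<bullet> f x\<bar>) / measure lebesgue Q0"
      for a and f :: "real^'d \<Rightarrow> real^'n"
      unfolding cube_avg_def set_lebesgue_integral_def
      by (intro arg_cong2[where f="(/)"] Bochner_Integration.integral_cong refl) (auto simp: indicator_def)
    have ag_nonneg: "0 \<le> ag i" and ah_nonneg: "0 \<le> ah i" for i
      unfolding ag_def ah_def cube_avg_def by (simp_all add: set_integral_abs_nonneg)
    have ag_le: "ag i \<le> CA" if "i < n" for i
    proof -
      obtain k where "k \<in> ?K" "w i \<bullet> k = ag i"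
        unfolding ag_def g_def avg_cut using avg_set_inner_attains[OF f(1) cQ0(2)] by metis
      then show ?thesis using w that by fastforce
    qed
    \<comment> \<open>Here it matters that \<open>b i\<close> belongs to the body of
      \<open>f1\<close>: its product with an element of the body of \<open>f2\<close> is one of the
      values under the supremum in \<open>set_pair\<close>.\<close>
    have ah_le: "ah i \<le> \<sigma>" if "i < n" for i
    proof -
      obtain k where k: "k \<in> ?H" "b i \<bullet> k = ah i"
        unfolding ah_def h_def avg_cut using avg_set_inner_attains[OF f(2) cQ0(2)] by metis
      have "b i \<bullet> k \<le> \<sigma>" unfolding \<sigma>_def using set_pair_upper[OF K _ k(1)] b that by blast
      then show ?thesis using k by simp
    qed
    \<comment> \<open>The boolean tells the \<open>g i\<close> from the \<open>h i\<close>, so that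
      one stopping family serves all of them.\<close>
    define I where "I = (UNIV::bool set) \<times> {..<n}"
    define u where "u p = (if fst p then g (snd p) else h (snd p))" for p :: "bool \<times> nat"
    have I: "finite I" "2 * real (card I) \<le> A" by (auto simp: I_def A_def card_cartesian_product)
    have iu: "integrable lebesgue (u p)" for p using ig ih by (simp add: u_def)
    obtain RR where RR: "RR \<subseteq> D" "\<And>R. R \<in> RR \<Longrightarrow> R \<subseteq> Q0"
      and dis: "\<And>R R' x. R \<in> RR \<Longrightarrow> R' \<in> RR \<Longrightarrow> x \<in> R \<Longrightarrow> x \<in> R' \<Longrightarrow> R = R'"
      and RRm: "\<Union>RR \<in> lmeasurable" "measure lebesgue (\<Union>RR) \<le> measure lebesgue Q0 / 2"
      and free: "\<And>Q p. Q \<in> D \<Longrightarrow> Q \<subseteq> Q0 \<Longrightarrow> (\<And>R. R \<in> RR \<Longrightarrow> \<not> Q \<subseteq> R) \<Longrightarrow> p \<in> I \<Longrightarrow>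
         (LINT x:Q|lebesgue. \<bar>u p x\<bar>) \<le> A * cube_avg (\<lambda>x. \<bar>u p x\<bar>) Q0 * measure lebesgue Q"
      and stop: "\<And>R p. R \<in> RR \<Longrightarrow> p \<in> I \<Longrightarrow>
         (LINT x:R|lebesgue. \<bar>u p x\<bar>) \<le> 2^CARD('d) * (A * cube_avg (\<lambda>x. \<bar>u p x\<bar>) Q0) * measure lebesgue R"
      by (rule CZ_stopping_cubes[where u = u, OF D Q0 I(1) iu A I(2)]) blast
    have free': "(LINT x:Q|lebesgue. \<bar>u p x\<bar>) \<le> B * cube_avg (\<lambda>x. \<bar>u p x\<bar>) Q0 * measure lebesgue Q"
      if "Q \<in> D" "\<And>R. R \<in> RR \<Longrightarrow> \<not> Q \<subseteq> R" "p \<in> I" for Q p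
    proof -
      have a0: "0 \<le> cube_avg (\<lambda>x. \<bar>u p x\<bar>) Q0"
        unfolding cube_avg_def by (simp add: set_integral_abs_nonneg)
      have "(LINT x:Q|lebesgue. \<bar>u p x\<bar>) \<le> A * cube_avg (\<lambda>x. \<bar>u p x\<bar>) Q0 * measure lebesgue Q"
      proof (cases "Q \<subseteq> Q0")
        case True
        then show ?thesis using free that by blast
      next
        case False
        have "(LINT x:Q|lebesgue. \<bar>u p x\<bar>) \<le> cube_avg (\<lambda>x. \<bar>u p x\<bar>) Q0 * measure lebesgue Q"
          by (rule set_integral_cutoff_le[OF D Q0 that(1) False iu]) (simp add: u_def g0 h0)
        also have "\<dots> \<le> A * (cube_avg (\<lambda>x. \<bar>u p x\<bar>) Q0 * measure lebesgue Q)"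
          using A a0 mult_right_mono[of 1 A "cube_avg (\<lambda>x. \<bar>u p x\<bar>) Q0 * measure lebesgue Q"] by simp
        finally show ?thesis by (simp add: mult_ac)
      qed
      also have "\<dots> \<le> B * cube_avg (\<lambda>x. \<bar>u p x\<bar>) Q0 * measure lebesgue Q"
        using AB a0 by (intro mult_right_mono) auto
      finally show ?thesis .
    qed
    have stop': "(LINT x:R|lebesgue. \<bar>u p x\<bar>) \<le> B * cube_avg (\<lambda>x. \<bar>u p x\<bar>) Q0 * measure lebesgue R"
      if "R \<in> RR" "p \<in> I" for R p
      using stop[OF that] by (simp add: B_def mult_ac)
    have "\<bar>shift_form_vec QQ s f1 f2\<bar> \<le> C * real (max 1 (max m1 m2)) * (measure lebesgue Q0 * \<sigma>)"
      if s: "dyadic_shift D m1 m2 s" and QQ: "QQ \<subseteq> D" and QR: "\<forall>Q\<in>QQ. \<forall>R\<in>RR. \<not> Q \<subseteq> R"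
        and loc: "(\<forall>Q\<in>QQ. Q \<subseteq> Q0) \<or> (\<forall>x. x \<notin> Q0 \<longrightarrow> f1 x = 0 \<and> f2 x = 0)" for m1 m2 s QQ
    proof -
      define \<rho> where "\<rho> = real (max 1 (max m1 m2))"
      have \<rho>: "1 \<le> \<rho>" "real m1 \<le> \<rho>" "real m2 \<le> \<rho>" by (auto simp: \<rho>_def)
      define F where "F = nz_cubes s QQ"
      have FQ: "F \<subseteq> QQ" by (auto simp: F_def nz_cubes_def)
      have "F \<subseteq> nz_cubes s D" using QQ by (auto simp: F_def nz_cubes_def)
      then have F: "finite F" "F \<subseteq> D" using dyadic_shift_finite[OF s] FQ QQ by (auto intro: finite_subset)
      have FR: "\<not> Q \<subseteq> R" if "Q \<in> F" "R \<in> RR" for Q R using QR that FQ by blast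
      obtain PP where PP: "finite PP" "PP \<subseteq> D" "\<Union>PP = Q0"
        and PPdis: "\<And>P P' x. P \<in> PP \<Longrightarrow> P' \<in> PP \<Longrightarrow> x \<in> P \<Longrightarrow> x \<in> P' \<Longrightarrow> P = P'"
        and PPR: "\<And>P. P \<in> PP \<Longrightarrow> P \<in> RR \<or> (\<forall>R\<in>RR. \<not> P \<subseteq> R)"
        and ns: "\<And>Q P. Q \<in> F \<Longrightarrow> P \<in> PP \<Longrightarrow> \<not> Q \<subset> P"
        and PPsum: "(\<Sum>P\<in>PP. measure lebesgue P) = measure lebesgue Q0"
        by (rule CZ_finite_partition[OF D Q0 F RR dis FR]; assumption?) blast
      have PPu: "(LINT x:P|lebesgue. \<bar>u p x\<bar>) \<le> B * cube_avg (\<lambda>x. \<bar>u p x\<bar>) Q0 * measure lebesgue P"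
        if "P \<in> PP" "p \<in> I" for P p
        using PPR[OF that(1)] stop'[of P p] free'[of P p] that PP(2) by blast
      have scalar: "\<bar>shift_form QQ s (g i) (h i)\<bar> \<le> 9 * \<rho> * (B * CA * B) * (measure lebesgue Q0 * \<sigma>)" if i: "i < n" for i
      proof -
        have pI: "(True, i) \<in> I" "(False, i) \<in> I" using i by (auto simp: I_def)
        have "\<bar>shift_form QQ s (g i) (h i)\<bar>
          \<le> (5 + 2 * real m1 + 2 * real m2) * ((B * ag i) * (B * ah i)) * (\<Sum>P\<in>PP. measure lebesgue P)"
        proof (rule shift_form_scalar_bound[OF D s PP(1,2) QQ])
          show "P = P'" if "P \<in> PP" "P' \<in> PP" "x \<in> P" "x \<in> P'" for P P' x using PPdis[OF that] .
          show "(LINT x:P|lebesgue. \<bar>g i x\<bar>) \<le> B * ag i * measure lebesgue P" if "P \<in> PP" for P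
            using PPu[OF that pI(1)] by (simp add: u_def ag_def)
          show "(LINT x:P|lebesgue. \<bar>h i x\<bar>) \<le> B * ah i * measure lebesgue P" if "P \<in> PP" for P
            using PPu[OF that pI(2)] by (simp add: u_def ah_def)
          show "(LINT x:Q|lebesgue. \<bar>h i x\<bar>) \<le> B * ah i * measure lebesgue Q" if "Q \<in> nz_cubes s QQ" for Q
            using free'[of Q, OF _ _ pI(2)] FR[of Q] that F(2) by (auto simp: u_def ah_def F_def)
          show "\<not> Q \<subset> P" if "Q \<in> nz_cubes s QQ" "P \<in> PP" for Q P using ns that F_def by blast
        qed (use ig ih g0 h0 AB ag_nonneg ah_nonneg PP(3) in auto)
        also have "\<dots> \<le> (9 * \<rho>) * ((B * CA) * (B * \<sigma>)) * measure lebesgue Q0"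
          unfolding PPsum
        proof (intro mult_right_mono mult_mono)
          show "5 + 2 * real m1 + 2 * real m2 \<le> 9 * \<rho>" using \<rho> by linarith
        qed (use AB CA \<rho> ag_nonneg ah_nonneg ag_le[OF i] ah_le[OF i] in auto)
        finally show ?thesis by (simp add: mult_ac)
      qed
      have "shift_form_vec QQ s f1 f2 = (\<Sum>Q\<in>F. \<Sum>j\<in>UNIV. cube_form s Q (\<lambda>x. f1 x $ j) (\<lambda>x. f2 x $ j))"
        unfolding shift_form_vec_def shift_form_eq F_def by (rule sum.swap)
      also have "\<dots> = (\<Sum>Q\<in>F. \<Sum>i<n. cube_form s Q (g i) (h i))"
      proof (rule sum.cong[OF refl])
        fix Q assume Q: "Q \<in> F"
        then have "Q \<in> D" "Q \<subseteq> Q0 \<or> (\<forall>x. x \<notin> Q0 \<longrightarrow> f1 x = 0 \<and> f2 x = 0)"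
          using F(2) FQ loc by blast+
        then show "(\<Sum>j\<in>UNIV. cube_form s Q (\<lambda>x. f1 x $ j) (\<lambda>x. f2 x $ j)) = (\<Sum>i<n. cube_form s Q (g i) (h i))"
          unfolding g_def[abs_def] h_def[abs_def]
          by (intro cube_form_vec_eq[OF D s _ cQ0(1) f] rep[rule_format])
      qed
      also have "\<dots> = (\<Sum>i<n. shift_form QQ s (g i) (h i))"
        unfolding shift_form_eq F_def by (rule sum.swap)
      finally have "\<bar>shift_form_vec QQ s f1 f2\<bar> \<le> (\<Sum>i<n. \<bar>shift_form QQ s (g i) (h i)\<bar>)"
        by (simp only: sum_abs)
      also have "\<dots> \<le> (\<Sum>i<n. 9 * \<rho> * (B * CA * B) * (measure lebesgue Q0 * \<sigma>))"
        by (intro sum_mono scalar) simp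
      also have "\<dots> = C * \<rho> * (measure lebesgue Q0 * \<sigma>)" by (simp add: C_def mult_ac)
      finally show ?thesis by (simp only: \<rho>_def)
    qed
    then have "stopping_family D f1 f2 C Q0 RR"
      unfolding stopping_family_def \<sigma>_def using RR RRm dis by (intro conjI allI impI ballI) blast+
    then show "\<exists>RR. stopping_family D f1 f2 C Q0 RR" ..
  qed
qed

section \<open>The sparse family\<close>

definition select_rel :: "('a set \<Rightarrow> 'a set set) \<Rightarrow> 'a set \<Rightarrow> 'a set \<Rightarrow> bool" where
  "select_rel ch P R \<longleftrightarrow> R \<in> ch P"

text \<open>Reachability rather than a union of generations: disjointness of the major subsets is
  then argued by comparing paths from the top cube.\<close>

definition selected :: "('a set \<Rightarrow> 'a set set) \<Rightarrow> 'a set \<Rightarrow> 'a set set" where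
  "selected ch T = {P. (select_rel ch)\<^sup>*\<^sup>* T P}"

lemma selected_top: "T \<in> selected ch T"
  by (simp add: selected_def)

lemma selected_step: "P \<in> selected ch T \<Longrightarrow> R \<in> ch P \<Longrightarrow> R \<in> selected ch T"
  unfolding selected_def by (auto intro: rtranclp.rtrancl_into_rtrancl simp: select_rel_def)

lemma selected_subset:
  assumes "\<And>Q. Q \<in> D \<Longrightarrow> ch Q \<subseteq> D" "T \<in> D"
  shows "selected ch T \<subseteq> D"
proof
  fix P assume "P \<in> selected ch T"
  then have "(select_rel ch)\<^sup>*\<^sup>* T P" by (simp add: selected_def)
  then show "P \<in> D"
    by induction (use assms in \<open>auto simp: select_rel_def\<close>)
qed

lemma select_rel_subset:
  assumes "\<And>Q. Q \<in> D \<Longrightarrow> ch Q \<subseteq> D" "\<And>Q R. Q \<in> D \<Longrightarrow> R \<in> ch Q \<Longrightarrow> R \<subseteq> Q"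
    and "(select_rel ch)\<^sup>*\<^sup>* P Q" "P \<in> D"
  shows "Q \<in> D \<and> Q \<subseteq> P"
  using assms(3)
proof induction
  case (step y z)
  then show ?case using assms(1,2)[of y] unfolding select_rel_def by blast
qed (use assms(4) in simp)

text \<open>Induction along the path to \<open>P\<close>. If \<open>Q\<close> is properly below the
  previous cube \<open>y\<close>, the first step from \<open>y\<close> towards \<open>Q\<close>
  leads to a cube of \<open>ch y\<close> that meets \<open>z\<close>, hence to \<open>z\<close>
  itself; if \<open>Q\<close> is \<open>y\<close> or above it, then it is above \<open>z\<close> as
  well.\<close>

lemma selected_comparable:
  assumes D: "\<And>Q. Q \<in> D \<Longrightarrow> ch Q \<subseteq> D" "\<And>Q R. Q \<in> D \<Longrightarrow> R \<in> ch Q \<Longrightarrow> R \<subseteq> Q" "T \<in> D"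
    and dis: "\<And>Q R R'. Q \<in> D \<Longrightarrow> R \<in> ch Q \<Longrightarrow> R' \<in> ch Q \<Longrightarrow> R \<inter> R' \<noteq> {} \<Longrightarrow> R = R'"
    and P: "(select_rel ch)\<^sup>*\<^sup>* T P" and Q: "Q \<in> selected ch T" and ne: "P \<inter> Q \<noteq> {}"
  shows "(select_rel ch)\<^sup>*\<^sup>* P Q \<or> (select_rel ch)\<^sup>*\<^sup>* Q P"
  using P ne
proof (induction rule: rtranclp_induct)
  case base
  then show ?case using Q by (simp add: selected_def)
next
  case (step y z)
  have y: "y \<in> D" using select_rel_subset[OF D(1,2) step.hyps(1) D(3)] by blast
  have z: "z \<in> ch y" using step.hyps(2) by (simp add: select_rel_def)
  have "z \<subseteq> y" using D(2) y z by blast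
  then have "y \<inter> Q \<noteq> {}" using step.prems by blast
  then consider "(select_rel ch)\<^sup>*\<^sup>* y Q" | "(select_rel ch)\<^sup>*\<^sup>* Q y" using step.IH by blast
  then show ?case
  proof cases
    case 1
    then show ?thesis
    proof (cases rule: converse_rtranclpE)
      case base
      then show ?thesis using step.hyps(2) by blast
    next
      case (step r)
      then have r: "r \<in> ch y" by (simp add: select_rel_def)
      have "Q \<subseteq> r" using select_rel_subset[OF D(1,2) step(2)] D(1)[OF y] r by blast
      then have "r = z" using dis[OF y r z] \<open>z \<inter> Q \<noteq> {}\<close> by blast
      then show ?thesis using step(2) by blast
    qed
  next
    case 2
    then show ?thesis using step.hyps(2) by (meson rtranclp.rtrancl_into_rtrancl)
  qed
qed

section \<open>Sparse domination: each cube of the shift is charged to one selected cube\<close>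

theorem theorem3p1:
  "\<exists>(C::real) (\<eta>::real). 0 < \<eta> \<and> \<eta> < 1 \<and>
    (\<forall>(f1::real^'d \<Rightarrow> real^'n) (f2::real^'d \<Rightarrow> real^'n) (D::(real^'d) set set).
       integrable lebesgue f1 \<and> integrable lebesgue f2 \<and>
       compact_support f1 \<and> compact_support f2 \<and> dyadic_lattice D \<longrightarrow>
       (\<exists>S. S \<subseteq> D \<and> sparse \<eta> S \<and>
          (\<forall>(\<rho>::nat) m1 m2 s. 1 \<le> \<rho> \<and> max 1 (max m1 m2) = \<rho> \<and> dyadic_shift D m1 m2 s \<longrightarrow>
             ennreal \<bar>shift_form_vec D s f1 f2\<bar>
               \<le> ennreal (C * real \<rho>) *
                 (\<integral>\<^sup>+ Q. ennreal (measure lebesgue Q * set_pair (avg_set f1 Q) (avg_set f2 Q))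
                    \<partial>count_space S))))"
proof -
  obtain C where C: "0 \<le> C" and ex: "\<And>(f1::real^'d \<Rightarrow> real^'n) f2 D Q0. integrable lebesgue f1 \<Longrightarrow>
      integrable lebesgue f2 \<Longrightarrow> dyadic_lattice D \<Longrightarrow> Q0 \<in> D \<Longrightarrow> \<exists>RR. stopping_family D f1 f2 C Q0 RR"
    using ex_stopping_family[where 'd='d and 'n='n] by blast
  have main: "\<exists>S. S \<subseteq> D \<and> sparse (1/2) S \<and>
          (\<forall>(\<rho>::nat) m1 m2 s. 1 \<le> \<rho> \<and> max 1 (max m1 m2) = \<rho> \<and> dyadic_shift D m1 m2 s \<longrightarrow>
             ennreal \<bar>shift_form_vec D s f1 f2\<bar>
               \<le> ennreal (C * real \<rho>) *
                 (\<integral>\<^sup>+ Q. ennreal (measure lebesgue Q * set_pair (avg_set f1 Q) (avg_set f2 Q))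
                    \<partial>count_space S))"
    if f: "integrable lebesgue f1" "integrable lebesgue f2"
      and supp: "compact_support f1" "compact_support f2" and D: "dyadic_lattice D"
    for f1 f2 :: "real^'d \<Rightarrow> real^'n" and D
  proof -
    obtain T where T: "T \<in> D" and T0: "\<And>x. x \<notin> T \<Longrightarrow> f1 x = 0 \<and> f2 x = 0"
    proof -
      obtain K1 K2 where K: "compact K1" "compact K2" "\<And>x. x \<notin> K1 \<Longrightarrow> f1 x = 0" "\<And>x. x \<notin> K2 \<Longrightarrow> f2 x = 0"
        using supp unfolding compact_support_def by blast
      have "compact (K1 \<union> K2)" using K(1,2) by (rule compact_Un)
      then obtain T where "T \<in> D" "K1 \<union> K2 \<subseteq> T" using D unfolding dyadic_lattice_def by blast
      then show ?thesis using K that by blast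
    qed
    \<comment> \<open>The choice does not involve the shift or its complexity, so the family
      generated from it is fixed before any shift is considered.\<close>
    define ch where "ch Q = (SOME RR. stopping_family D f1 f2 C Q RR)" for Q
    have ch: "stopping_family D f1 f2 C Q (ch Q)" if "Q \<in> D" for Q
      unfolding ch_def by (rule someI_ex[OF ex[OF f D that]])
    have chD: "ch Q \<subseteq> D" and ch_meas: "\<Union>(ch Q) \<in> lmeasurable"
      and ch_half: "measure lebesgue (\<Union>(ch Q)) \<le> measure lebesgue Q / 2" if "Q \<in> D" for Q
      using ch[OF that] by (auto simp: stopping_family_def)
    have ch_sub: "R \<subseteq> Q" if "Q \<in> D" "R \<in> ch Q" for Q R
      using ch[OF that(1)] that(2) by (simp add: stopping_family_def)
    have ch_dis: "R = R'" if "Q \<in> D" "R \<in> ch Q" "R' \<in> ch Q" "R \<inter> R' \<noteq> {}" for Q R R'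
      using ch[OF that(1)] that(2-) unfolding stopping_family_def by blast
    have cube: "is_cube Q" "Q \<in> lmeasurable" "0 < measure lebesgue Q" if "Q \<in> D" for Q
      using lattice_is_cube[OF D that] is_cube_lmeasurable[of Q] is_cube_measure_pos[of Q] by auto
    define S where "S = selected ch T"
    have SD: "S \<subseteq> D" unfolding S_def by (rule selected_subset[OF chD T])
    define E where "E Q = Q - \<Union>(ch Q)" for Q
    have sparse: "sparse (1/2) S"
      unfolding sparse_def
    proof (intro exI[of _ E] conjI ballI impI)
      fix Q assume "Q \<in> S"
      then have Q: "Q \<in> D" using SD by blast
      show "E Q \<subseteq> Q" by (auto simp: E_def)
      show "E Q \<in> sets lebesgue" unfolding E_def using cube(2)[OF Q] ch_meas[OF Q] by auto
      have "measure lebesgue (E Q) = measure lebesgue Q - measure lebesgue (\<Union>(ch Q))"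
        unfolding E_def
        by (rule measurable_measure_Diff[OF cube(2)[OF Q] fmeasurableD[OF ch_meas[OF Q]]])
          (use ch_sub[OF Q] in blast)
      then show "1 / 2 * measure lebesgue Q \<le> measure lebesgue (E Q)" using ch_half[OF Q] by simp
    next
      \<comment> \<open>The first step of a path from \<open>P\<close> to another cube
        \<open>Q\<close> leads to a cube of \<open>ch P\<close> containing \<open>Q\<close>, and
        \<open>E P\<close> leaves out all of these.\<close>
      have half: "E P \<inter> E Q = {}" if "P \<in> D" "P \<noteq> Q" "(select_rel ch)\<^sup>*\<^sup>* P Q" for P Q
        using that(3)
      proof (cases rule: converse_rtranclpE)
        case (step r)
        then have r: "r \<in> ch P" by (simp add: select_rel_def)
        then have "Q \<subseteq> r" using select_rel_subset[OF chD ch_sub step(2)] chD[OF that(1)] by blast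
        then show ?thesis using r by (auto simp: E_def)
      qed (use that in simp)
      fix P Q assume PQ: "P \<in> S" "Q \<in> S" "P \<noteq> Q"
      show "E P \<inter> E Q = {}"
      proof (cases "P \<inter> Q = {}")
        case False
        have "(select_rel ch)\<^sup>*\<^sup>* P Q \<or> (select_rel ch)\<^sup>*\<^sup>* Q P"
          by (rule selected_comparable[OF chD ch_sub T ch_dis])
            (use PQ False in \<open>auto simp: S_def selected_def\<close>)
        then show ?thesis using half[of P Q] half[of Q P] PQ SD by blast
      qed (auto simp: E_def)
    qed
    have "ennreal \<bar>shift_form_vec D s f1 f2\<bar> \<le> ennreal (C * real \<rho>) *
        (\<integral>\<^sup>+ Q. ennreal (measure lebesgue Q * set_pair (avg_set f1 Q) (avg_set f2 Q)) \<partial>count_space S)"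
      if \<rho>: "max 1 (max m1 m2) = \<rho>" and s: "dyadic_shift D m1 m2 s" for \<rho> m1 m2 s
    proof -
      define F where "F = nz_cubes s D"
      have F: "finite F" "F \<subseteq> D" using dyadic_shift_finite[OF s] by (auto simp: F_def nz_cubes_def)
      \<comment> \<open>\<open>P\<close> may be charged for \<open>Q\<close> if no stopping cube of
        \<open>P\<close> contains \<open>Q\<close>. The last alternative lets the top cube take
        cubes not contained in it, which its estimate permits because both functions vanish outside
        \<open>T\<close>.\<close>
      define home where "home Q P \<longleftrightarrow> P \<in> S \<and> (\<forall>R\<in>ch P. \<not> Q \<subseteq> R) \<and> (Q \<subseteq> P \<or> P = T)" for Q P
      have ex_home: "\<exists>P. home Q P" if Q: "Q \<in> F" for Q
      proof (rule ccontr)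
        assume no: "\<nexists>P. home Q P"
        have QD: "Q \<in> D" using F Q by blast
        \<comment> \<open>Without a home the descent never stops: each selected cube hands
          \<open>Q\<close> on to a stopping cube around it of at most half the measure, while
          \<open>Q\<close> has positive measure. The last clause leaves out \<open>k = 0\<close>
          because \<open>T\<close> need not contain \<open>Q\<close>.\<close>
        have deep: "\<exists>P\<in>S. (Q \<subseteq> P \<or> P = T) \<and> measure lebesgue P \<le> measure lebesgue T / 2^k
            \<and> (k \<noteq> 0 \<longrightarrow> Q \<subseteq> P)" for k :: nat
        proof (induction k)
          case 0
          show ?case using selected_top[of T ch] by (auto simp: S_def)
        next
          case (Suc k)
          then obtain P where P: "P \<in> S" "Q \<subseteq> P \<or> P = T" "measure lebesgue P \<le> measure lebesgue T / 2^k" by blast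
          then obtain R where R: "R \<in> ch P" "Q \<subseteq> R" using no by (auto simp: home_def)
          have PD: "P \<in> D" using P SD by blast
          have "measure lebesgue R \<le> measure lebesgue (\<Union>(ch P))"
            using R chD[OF PD] cube(2) ch_meas[OF PD] by (intro measure_mono_fmeasurable) auto
          also have "\<dots> \<le> measure lebesgue P / 2" by (rule ch_half[OF PD])
          also have "\<dots> \<le> measure lebesgue T / 2^Suc k" using P(3) by (simp add: field_simps)
          finally show ?case using R selected_step[of P ch T R] P by (auto simp: S_def)
        qed
        have mono: "measure lebesgue Q \<le> measure lebesgue T * (1/2)^Suc k" for k
        proof -
          obtain P where P: "P \<in> S" "measure lebesgue P \<le> measure lebesgue T / 2^Suc k" "Q \<subseteq> P"
            using deep[of "Suc k"] by blast
          then have "measure lebesgue Q \<le> measure lebesgue P"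
            using SD cube(2) QD by (intro measure_mono_fmeasurable) auto
          then have "measure lebesgue Q \<le> measure lebesgue T / 2^Suc k" using P by linarith
          then show ?thesis by (simp add: power_one_over)
        qed
        have "(\<lambda>k. measure lebesgue T * (1/2)^Suc k) \<longlonglongrightarrow> measure lebesgue T * 0"
          by (intro tendsto_mult tendsto_const LIMSEQ_Suc LIMSEQ_power_zero) simp
        then have "measure lebesgue Q \<le> measure lebesgue T * 0"
          by (rule LIMSEQ_le_const) (use mono in blast)
        then show False using cube(3)[OF QD] by simp
      qed
      \<comment> \<open>One home is chosen, so that no cube of the shift is counted twice.\<close>
      define \<pi> where "\<pi> Q = (SOME P. home Q P)" for Q
      have \<pi>: "home Q (\<pi> Q)" if "Q \<in> F" for Q unfolding \<pi>_def by (rule someI_ex[OF ex_home[OF that]])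
      define G where "G = \<pi> ` F"
      have G: "finite G" "G \<subseteq> S" using F \<pi> by (auto simp: G_def home_def)
      define part where "part P = {Q\<in>F. \<pi> Q = P}" for P
      have form_part: "shift_form D s u v = (\<Sum>P\<in>G. shift_form (part P) s u v)" for u v
      proof -
        have nz: "nz_cubes s (part P) = {Q\<in>F. \<pi> Q = P}" for P
          by (auto simp: part_def F_def nz_cubes_def)
        show ?thesis
          unfolding shift_form_eq nz G_def F_def[symmetric] by (rule sum.image_gen[OF F(1)])
      qed
      have vec_part: "shift_form_vec D s f1 f2 = (\<Sum>P\<in>G. shift_form_vec (part P) s f1 f2)"
        unfolding shift_form_vec_def form_part by (rule sum.swap)
      let ?a = "\<lambda>P. measure lebesgue P * set_pair (avg_set f1 P) (avg_set f2 P)"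
      have a0: "0 \<le> ?a P" for P
        using set_pair_upper[OF avg_set_bounded[OF f(1)] avg_set_bounded[OF f(2)]
            zero_in_avg_set zero_in_avg_set, of P P] by simp
      have piece: "\<bar>shift_form_vec (part P) s f1 f2\<bar> \<le> C * real \<rho> * ?a P" if "P \<in> G" for P
      proof -
        have PD: "P \<in> D" using that G SD by blast
        have hm: "home Q P" if "Q \<in> part P" for Q using \<pi> that by (auto simp: part_def)
        have "part P \<subseteq> D" using F by (auto simp: part_def)
        moreover have "\<forall>Q\<in>part P. \<forall>R\<in>ch P. \<not> Q \<subseteq> R" using hm by (auto simp: home_def)
        moreover have "(\<forall>Q\<in>part P. Q \<subseteq> P) \<or> (\<forall>x. x \<notin> P \<longrightarrow> f1 x = 0 \<and> f2 x = 0)"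
          using hm T0 by (cases "P = T") (auto simp: home_def)
        ultimately show ?thesis
          using ch[OF PD] s unfolding stopping_family_def \<rho>[symmetric] by blast
      qed
      have "\<bar>shift_form_vec D s f1 f2\<bar> \<le> (\<Sum>P\<in>G. C * real \<rho> * ?a P)"
        unfolding vec_part by (intro order_trans[OF sum_abs] sum_mono piece)
      also have "\<dots> = C * real \<rho> * (\<Sum>P\<in>G. ?a P)" by (simp add: sum_distrib_left)
      finally have "ennreal \<bar>shift_form_vec D s f1 f2\<bar> \<le> ennreal (C * real \<rho> * (\<Sum>P\<in>G. ?a P))"
        by (rule ennreal_leI)
      also have "\<dots> = ennreal (C * real \<rho>) * ennreal (\<Sum>P\<in>G. ?a P)"
        using C a0 by (intro ennreal_mult sum_nonneg) auto
      \<comment> \<open>The selected family may be infinite, so its sum is taken as an extended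
        nonnegative integral; a single shift charges only the finite subfamily
        \<open>G\<close>.\<close>
      also have "ennreal (\<Sum>P\<in>G. ?a P) = (\<integral>\<^sup>+ P. ennreal (?a P) \<partial>count_space G)"
        using a0 G(1) by (simp add: nn_integral_count_space_finite)
      also have "\<dots> = (\<integral>\<^sup>+ P. ennreal (?a P) * indicator G P \<partial>count_space S)"
        using G(2) by (subst nn_integral_count_space_indicator) (auto simp: nn_integral_restrict_space[symmetric] restrict_count_space Int_absorb1 Int_absorb2)
      also have "ennreal (C * real \<rho>) * \<dots> \<le> ennreal (C * real \<rho>) * (\<integral>\<^sup>+ P. ennreal (?a P) \<partial>count_space S)"
        by (intro mult_left_mono nn_integral_mono) (auto simp: indicator_def)
      finally show ?thesis .
    qed
    then show ?thesis using SD sparse by blast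
  qed
  show ?thesis
    by (rule exI[of _ C], rule exI[of _ "1/2"]) (use main in \<open>auto\<close>)
qed

end
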